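(* Let $p^*$ be a KKT point of the central NLP for which Assumption 1 and Assumption 2 (both stated in the context) hold. Suppose furthermore that the central NLP is of neighbor-affine form, i.e. $f_i=f_{ii}(x_i)+\sum_{j\in\mathcal N_i}f_{ij}(x_i,x_j)$, $g_i=g_{ii}(x_i)+\sum_{j\in\mathcal N_i}g_{ij}(x_i,x_j)$, $h_i=h_{ii}(x_i)+\sum_{j\in\mathcal N_i}h_{ij}(x_i,x_j)$ for all $i\in\mathcal V$, and that for all $i\in\mathcal V$, $j\in\mathcal N_i$, at the minimizer $x^*$, $$\nabla^2_{x_ix_j}f_{ij}=\nabla^2_{x_jx_j}f_{ij}=0,\qquad \nabla_{x_j}g_{ij}=\nabla^2_{x_ix_j}g_{ij}=\nabla^2_{x_jx_j}g_{ij}=0,\qquad \nabla_{x_j}h_{ij}=\nabla^2_{x_ix_j}h_{ij}=\nabla^2_{x_jx_j}h_{ij}=0 .$$ Then the order of convergence of Algorithm 2 is quadratic; that is, there exist $r>0$ and $\tilde C<\infty$ such that for every $p^0\in\mathcal B_r(p^* )$ the sequence $\{p^q\}$ generated by Algorithm 2 converges to $p^*$ and satisfies $\|p^q-p^*\|\le\tilde C\|p^{q-1}-p^*\|^2$ for all $q=1,2,\dots$.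
   Context: **Central NLP.** Let $\mathcal G=(\mathcal V,\mathcal E)$ be a connected undirected graph with $\mathcal V=\{1,\dots,M\}$ and neighbor sets $\mathcal N_i=\{j\in\mathcal V: (i,j)\in\mathcal E,\ j\ne i\}$. Agent $i$ has the decision variable $x_i\in\mathbb R^{n_i}$; write $x_{\mathcal N_i}=[x_j]_{j\in\mathcal N_i}$ (stacked). The central NLP is $$\min_{x_1,\dots,x_M}\ \sum_{i\in\mathcal V} f_i(x_i,x_{\mathcal N_i})\quad\text{s.t. } g_i(x_i,x_{\mathcal N_i})=0,\quad h_i(x_i,x_{\mathcal N_i})\le 0,\quad i\in\mathcal V,$$ with $f_i$ real-valued and $g_i$, $h_i$ vector-valued; all functions are at least three times continuously differentiable. Second derivatives of vector-valued functions are understood componentwise. Put $L_i(x_i,\lambda_i,\mu_i,x_{\mathcal N_i})=f_i+\lambda_i^\top g_i+\mu_i^\top h_i$, $L=\sum_{i} L_i$, $x=[x_i]_i$, $\lambda=[\lambda_i]_i$, $\mu=[\mu_i]_i$, $g(x)=[g_i]_{i}$, $h(x)=[h_i]_{i}$, $p_i=[x_i^\top,\lambda_i^\top,\mu_i^\top]^\top$, $p=[p_i]_{i\in\mathcal V}$, $U_i=\mathrm{diag}(\mu_i)$. $\|\cdot\|$ is the Euclidean norm; $\mathcal B_r(p^* )$ is the open ball of radius $r$ around $p^*$. **Central KKT conditions:** $\nabla_{x_i}L(x,\lambda,\mu)=0$, $g_i=0$, $U_ih_i=0$, $h_i\le0$, $\mu_i\ge0$ for all $i\in\mathcal V$. **Local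 NLPs.** Given $\bar p=[\bar p_i]_i$, agent $i$ solves $$\min_{x_i}\ f_i(x_i,\bar x_{\mathcal N_i})+\sum_{j\in\mathcal N_i}\big(\nabla_{x_i}L_j(\bar x_j,\bar\lambda_j,\bar\mu_j,\bar x_{\mathcal N_j})\big)^\top(x_i-\bar x_i)\ \text{ s.t. } g_i(x_i,\bar x_{\mathcal N_i})=0,\ h_i(x_i,\bar x_{\mathcal N_i})\le0 .$$ The KKT conditions for all agents together are $\hat F(p,\bar p)=0$ together with $h_i(x_i,\bar x_{\mathcal N_i})\le 0$, $\mu_i\ge0$ for all $i$, where $$\hat F(p,\bar p)=\begin{bmatrix}\nabla_{x_i}L_i(x_i,\lambda_i,\mu_i,\bar x_{\mathcal N_i})+\sum_{j\in\mathcal N_i}\nabla_{x_i}L_j(\bar x_j,\bar\lambda_j,\bar\mu_j,\bar x_{\mathcal N_j})\\ g_i(x_i,\bar x_{\mathcal N_i})\\ U_ih_i(x_i,\bar x_{\mathcal N_i})\end{bmatrix}_{i\in\mathcal V}.$$ **Assumption 1.** The central NLP has a KKT point $p^*$ such that (i) $[\mu^*]_k>0$ whenever $[h(x^* )]_k=0$; (ii) $s^\top\nabla^2_{xx}L(x^*,\lambda^*,\mu^* )s>0$ for all $s\ne0$ with $\nabla_xg(x^* )s=0$ and $[\nabla_xh(x^* )]_{\mathcal A(x^* )}s=0$, where $\mathcal A(x)=\{k:[h(x)]_k=0\}$ and $[\cdot]_{\mathcal A}$ selects rows; (iii) the columns of $[\nabla_xg(x^* )^\top,[\nabla_xh(x^*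 )]_{\mathcal A(x^* )}^\top]$ are linearly independent. **Assumption 2.** For every $i\in\mathcal V$, with $\mathcal A_i=\{k:[h_i(x_i^*,x^*_{\mathcal N_i})]_k=0\}$: (i) $s_i^\top\nabla^2_{x_ix_i}L_i(x_i^*,\lambda_i^*,\mu_i^*,x^*_{\mathcal N_i})s_i>0$ for all $s_i\ne0$ with $\nabla_{x_i}g_i(x_i^*,x_{\mathcal N_i}^* )s_i=0$ and $[\nabla_{x_i}h_i(x_i^*,x_{\mathcal N_i}^* )]_{\mathcal A_i}s_i=0$; (ii) the columns of $[\nabla_{x_i}g_i(x_i^*,x_{\mathcal N_i}^* )^\top,[\nabla_{x_i}h_i(x_i^*,x_{\mathcal N_i}^* )]_{\mathcal A_i}^\top]$ are linearly independent. **Algorithm 2 (neighbor-affine SBDP).** Under Assumptions 1 and 2, near $p^*$ there is a single-valued $C^1$ mapping $\Phi$ with $\Phi(p^* )=p^*$ such that for $\bar p$ near $p^*$, $\Phi(\bar p)$ is the locally unique (near $p^*$) solution of the concatenated local KKT systems with parameter $\bar p$. In iteration $q$ all agents solve in parallel their local NLPs with $\bar p=p^{q-1}$, giving $p^q=\Phi(p^{q-1})$, started at $p^0$. *)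

theory Defs
  imports "HOL-Analysis.Analysis"
begin

section \<open>Partial derivatives and smoothness on \<open>\<real>\<^sup>k\<close>\<close>

definition pd :: "'k::finite \<Rightarrow> (real ^ 'k \<Rightarrow> real) \<Rightarrow> real ^ 'k \<Rightarrow> real" where
  "pd k F p = frechet_derivative F (at p) (axis k 1)"

primrec Ck :: "nat \<Rightarrow> (real ^ 'k::finite \<Rightarrow> real) \<Rightarrow> bool" where
  "Ck 0 F \<longleftrightarrow> continuous_on UNIV F"
| "Ck (Suc n) F \<longleftrightarrow> F differentiable_on UNIV \<and> (\<forall>k. Ck n (pd k F))"

definition C1_map_on :: "(real ^ 'k::finite) set \<Rightarrow> (real ^ 'k \<Rightarrow> real ^ 'k) \<Rightarrow> bool" where
  "C1_map_on S \<Phi> \<longleftrightarrow>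
     (\<exists>D :: real ^ 'k \<Rightarrow> (real ^ 'k) \<Rightarrow>\<^sub>L (real ^ 'k).
        (\<forall>p\<in>S. (\<Phi> has_derivative blinfun_apply (D p)) (at p)) \<and> continuous_on S D)"

definition depends_only_on :: "'k::finite set \<Rightarrow> (real ^ 'k \<Rightarrow> real) \<Rightarrow> bool" where
  "depends_only_on S F \<longleftrightarrow> (\<forall>p q. (\<forall>k\<in>S. p $ k = q $ k) \<longrightarrow> F p = F q)"

section \<open>The distributed nonlinear program\<close>

text \<open>
  The stacked vector \<open>p = [x\<^sub>i, \<lambda>\<^sub>i, \<mu>\<^sub>i]\<^sub>i\<close> is an element of \<open>real ^ 'k\<close>. Each coordinate belongs to
  one agent and is an entry of its \<open>x\<^sub>i\<close>, its \<open>\<lambda>\<^sub>i\<close> or its \<open>\<mu>\<^sub>i\<close>; the block sizes may differ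
  between agents and may be zero, so problems without equality or without inequality
  constraints are covered. The entries of \<open>g\<^sub>i\<close> and \<open>h\<^sub>i\<close> are indexed by the coordinates of the
  corresponding multipliers: \<open>eqcon P k\<close> is meaningful only for multiplier coordinates \<open>k\<close> of kind
  \<open>Eq_Mult\<close>, and \<open>ineqcon P k\<close> only for those of kind \<open>Ineq_Mult\<close>. A function of some of the
  blocks \<open>x\<^sub>j\<close> is a function on \<open>real ^ 'k\<close> that depends only on the corresponding coordinates.
\<close>

datatype coord_kind = Primal | Eq_Mult | Ineq_Mult

record ('v, 'k) nlp =
  edges :: "('v \<times> 'v) set"
  agent :: "'k \<Rightarrow> 'v"
  kind :: "'k \<Rightarrow> coord_kind"
  cost :: "'v \<Rightarrow> real ^ 'k \<Rightarrow> real"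
  eqcon :: "'k \<Rightarrow> real ^ 'k \<Rightarrow> real"
  ineqcon :: "'k \<Rightarrow> real ^ 'k \<Rightarrow> real"

definition nbrs :: "('v::finite, 'k::finite) nlp \<Rightarrow> 'v \<Rightarrow> 'v set" where
  "nbrs P i = {j. (i, j) \<in> edges P \<and> j \<noteq> i}"

definition prims :: "('v::finite, 'k::finite) nlp \<Rightarrow> 'v \<Rightarrow> 'k set" where
  "prims P i = {k. agent P k = i \<and> kind P k = Primal}"

definition eqs :: "('v::finite, 'k::finite) nlp \<Rightarrow> 'v \<Rightarrow> 'k set" where
  "eqs P i = {k. agent P k = i \<and> kind P k = Eq_Mult}"

definition ineqs :: "('v::finite, 'k::finite) nlp \<Rightarrow> 'v \<Rightarrow> 'k set" where
  "ineqs P i = {k. agent P k = i \<and> kind P k = Ineq_Mult}"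

definition active :: "('v::finite, 'k::finite) nlp \<Rightarrow> 'v \<Rightarrow> real ^ 'k \<Rightarrow> 'k set" where
  "active P i p = {k \<in> ineqs P i. ineqcon P k p = 0}"

definition nbhd_prims :: "('v::finite, 'k::finite) nlp \<Rightarrow> 'v \<Rightarrow> 'k set" where
  "nbhd_prims P i = prims P i \<union> (\<Union>j\<in>nbrs P i. prims P j)"

definition central_nlp :: "('v::finite, 'k::finite) nlp \<Rightarrow> bool" where
  "central_nlp P \<longleftrightarrow>
     sym (edges P) \<and> (\<forall>i j. (i, j) \<in> (edges P)\<^sup>*) \<and>
     (\<forall>i. Ck 3 (cost P i) \<and> depends_only_on (nbhd_prims P i) (cost P i) \<and>
        (\<forall>k\<in>eqs P i. Ck 3 (eqcon P k) \<and> depends_only_on (nbhd_prims P i) (eqcon P k)) \<and>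
        (\<forall>k\<in>ineqs P i. Ck 3 (ineqcon P k) \<and> depends_only_on (nbhd_prims P i) (ineqcon P k)))"

definition lagr :: "('v::finite, 'k::finite) nlp \<Rightarrow> 'v \<Rightarrow> real ^ 'k \<Rightarrow> real" where
  "lagr P i p = cost P i p + (\<Sum>k\<in>eqs P i. p $ k * eqcon P k p)
     + (\<Sum>k\<in>ineqs P i. p $ k * ineqcon P k p)"

definition lagrangian :: "('v::finite, 'k::finite) nlp \<Rightarrow> real ^ 'k \<Rightarrow> real" where
  "lagrangian P p = (\<Sum>i\<in>UNIV. lagr P i p)"

definition central_KKT :: "('v::finite, 'k::finite) nlp \<Rightarrow> real ^ 'k \<Rightarrow> bool" where
  "central_KKT P p \<longleftrightarrow>
     (\<forall>i. (\<forall>k\<in>prims P i. pd k (lagrangian P) p = 0) \<and>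
        (\<forall>k\<in>eqs P i. eqcon P k p = 0) \<and>
        (\<forall>k\<in>ineqs P i. p $ k * ineqcon P k p = 0 \<and> ineqcon P k p \<le> 0 \<and> p $ k \<ge> 0))"

section \<open>Regularity of the central and the local problems\<close>

text \<open>
  Below, \<open>X\<close> is the set of primal coordinates with respect to which one differentiates, and \<open>G\<close>,
  \<open>A\<close> are the selected rows of the equality and inequality constraint Jacobians. Only the entries
  \<open>s $ k\<close> with \<open>k \<in> X\<close> of a direction \<open>s\<close> matter.
\<close>

definition second_order_cond ::
  "('v::finite, 'k::finite) nlp \<Rightarrow> 'k set \<Rightarrow> 'k set \<Rightarrow> 'k set \<Rightarrow> (real ^ 'k \<Rightarrow> real) \<Rightarrow> real ^ 'k \<Rightarrow> bool"
where
  "second_order_cond P X G A F p \<longleftrightarrow>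
     (\<forall>s :: real ^ 'k.
        (\<exists>k\<in>X. s $ k \<noteq> 0) \<longrightarrow>
        (\<forall>e\<in>G. (\<Sum>k\<in>X. pd k (eqcon P e) p * s $ k) = 0) \<longrightarrow>
        (\<forall>e\<in>A. (\<Sum>k\<in>X. pd k (ineqcon P e) p * s $ k) = 0) \<longrightarrow>
        (\<Sum>k\<in>X. \<Sum>l\<in>X. s $ k * pd k (pd l F) p * s $ l) > 0)"

definition constraint_gradients_independent ::
  "('v::finite, 'k::finite) nlp \<Rightarrow> 'k set \<Rightarrow> 'k set \<Rightarrow> 'k set \<Rightarrow> real ^ 'k \<Rightarrow> bool"
where
  "constraint_gradients_independent P X G A p \<longleftrightarrow>
     (\<forall>a b :: 'k \<Rightarrow> real.
        (\<forall>k\<in>X. (\<Sum>e\<in>G. a e * pd k (eqcon P e) p) + (\<Sum>e\<in>A. b e * pd k (ineqcon P e) p) = 0) \<longrightarrow>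
        (\<forall>e\<in>G. a e = 0) \<and> (\<forall>e\<in>A. b e = 0))"

definition central_regular :: "('v::finite, 'k::finite) nlp \<Rightarrow> real ^ 'k \<Rightarrow> bool" where
  "central_regular P p \<longleftrightarrow>
     (let X = \<Union>i. prims P i; G = \<Union>i. eqs P i; A = \<Union>i. active P i p in
        (\<forall>k\<in>A. p $ k > 0) \<and>
        second_order_cond P X G A (lagrangian P) p \<and>
        constraint_gradients_independent P X G A p)"

definition local_regular :: "('v::finite, 'k::finite) nlp \<Rightarrow> real ^ 'k \<Rightarrow> bool" where
  "local_regular P p \<longleftrightarrow>
     (\<forall>i. second_order_cond P (prims P i) (eqs P i) (active P i p) (lagr P i) p \<and>
        constraint_gradients_independent P (prims P i) (eqs P i) (active P i p) p)"

section \<open>The algorithm\<close>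

text \<open>
  \<open>mix P i p q\<close> takes agent \<open>i\<close>'s own variables and multipliers from \<open>p\<close> and everything else from
  \<open>q\<close>, so that \<open>lagr P i (mix P i p q)\<close> is \<open>L\<^sub>i\<close> evaluated at \<open>x\<^sub>i, \<lambda>\<^sub>i, \<mu>\<^sub>i\<close> of \<open>p\<close> and at the
  neighbours' variables of \<open>q\<close>.
\<close>

definition mix :: "('v::finite, 'k::finite) nlp \<Rightarrow> 'v \<Rightarrow> real ^ 'k \<Rightarrow> real ^ 'k \<Rightarrow> real ^ 'k" where
  "mix P i p q = (\<chi> k. if agent P k = i then p $ k else q $ k)"

definition Fhat :: "('v::finite, 'k::finite) nlp \<Rightarrow> real ^ 'k \<Rightarrow> real ^ 'k \<Rightarrow> real ^ 'k" where
  "Fhat P p q = (\<chi> k. let i = agent P k in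
     case kind P k of
       Primal \<Rightarrow> pd k (lagr P i) (mix P i p q) + (\<Sum>j\<in>nbrs P i. pd k (lagr P j) q)
     | Eq_Mult \<Rightarrow> eqcon P k (mix P i p q)
     | Ineq_Mult \<Rightarrow> p $ k * ineqcon P k (mix P i p q))"

definition local_KKT :: "('v::finite, 'k::finite) nlp \<Rightarrow> real ^ 'k \<Rightarrow> real ^ 'k \<Rightarrow> bool" where
  "local_KKT P p q \<longleftrightarrow>
     Fhat P p q = 0 \<and> (\<forall>i. \<forall>k\<in>ineqs P i. ineqcon P k (mix P i p q) \<le> 0 \<and> p $ k \<ge> 0)"

text \<open>
  Only the values of the solution map near \<open>ps\<close> are constrained. Any two solution maps agree on
  some neighbourhood of \<open>ps\<close>.
\<close>

definition solution_map ::
  "('v::finite, 'k::finite) nlp \<Rightarrow> real ^ 'k \<Rightarrow> (real ^ 'k \<Rightarrow> real ^ 'k) \<Rightarrow> bool"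
where
  "solution_map P ps \<Phi> \<longleftrightarrow>
     \<Phi> ps = ps \<and>
     (\<exists>\<delta>>0. \<exists>\<epsilon>>0. C1_map_on (ball ps \<delta>) \<Phi> \<and>
        (\<forall>q\<in>ball ps \<delta>. \<Phi> q \<in> ball ps \<epsilon> \<and> local_KKT P (\<Phi> q) q \<and>
           (\<forall>p\<in>ball ps \<epsilon>. local_KKT P p q \<longrightarrow> p = \<Phi> q)))"

definition generated_by :: "('a \<Rightarrow> 'a) \<Rightarrow> (nat \<Rightarrow> 'a) \<Rightarrow> bool" where
  "generated_by \<Phi> p \<longleftrightarrow> (\<forall>q\<ge>1. p q = \<Phi> (p (q - 1)))"

definition quadratically_convergent ::
  "(real ^ 'k::finite \<Rightarrow> real ^ 'k) \<Rightarrow> real ^ 'k \<Rightarrow> bool"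
where
  "quadratically_convergent \<Phi> ps \<longleftrightarrow>
     (\<exists>r>0. \<exists>C. \<forall>p. p 0 \<in> ball ps r \<longrightarrow> generated_by \<Phi> p \<longrightarrow>
        p \<longlonglongrightarrow> ps \<and> (\<forall>q\<ge>1. norm (p q - ps) \<le> C * (norm (p (q - 1) - ps))\<^sup>2))"

section \<open>Neighbor-affine form\<close>

text \<open>
  \<open>f0 i\<close>, \<open>f1 i j\<close> stand for \<open>f\<^bsub>ii\<^esub>\<close>, \<open>f\<^bsub>ij\<^esub>\<close>. For an entry \<open>k\<close> of \<open>g\<^sub>i\<close>, \<open>g0 k\<close> and \<open>g1 k j\<close> are
  the matching entries of \<open>g\<^bsub>ii\<^esub>\<close> and \<open>g\<^bsub>ij\<^esub>\<close>; likewise for \<open>h0\<close>, \<open>h1\<close>.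
\<close>

definition affine_split ::
  "('v::finite, 'k::finite) nlp \<Rightarrow> 'v \<Rightarrow> (real ^ 'k \<Rightarrow> real) \<Rightarrow> (real ^ 'k \<Rightarrow> real)
     \<Rightarrow> ('v \<Rightarrow> real ^ 'k \<Rightarrow> real) \<Rightarrow> bool"
where
  "affine_split P i F F0 F1 \<longleftrightarrow>
     (\<forall>p. F p = F0 p + (\<Sum>j\<in>nbrs P i. F1 j p)) \<and>
     Ck 3 F0 \<and> depends_only_on (prims P i) F0 \<and>
     (\<forall>j\<in>nbrs P i. Ck 3 (F1 j) \<and> depends_only_on (prims P i \<union> prims P j) (F1 j))"

definition neighbor_affine ::
  "('v::finite, 'k::finite) nlp
     \<Rightarrow> ('v \<Rightarrow> real ^ 'k \<Rightarrow> real) \<Rightarrow> ('v \<Rightarrow> 'v \<Rightarrow> real ^ 'k \<Rightarrow> real)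
     \<Rightarrow> ('k \<Rightarrow> real ^ 'k \<Rightarrow> real) \<Rightarrow> ('k \<Rightarrow> 'v \<Rightarrow> real ^ 'k \<Rightarrow> real)
     \<Rightarrow> ('k \<Rightarrow> real ^ 'k \<Rightarrow> real) \<Rightarrow> ('k \<Rightarrow> 'v \<Rightarrow> real ^ 'k \<Rightarrow> real) \<Rightarrow> bool"
where
  "neighbor_affine P f0 f1 g0 g1 h0 h1 \<longleftrightarrow>
     (\<forall>i. affine_split P i (cost P i) (f0 i) (f1 i) \<and>
        (\<forall>k\<in>eqs P i. affine_split P i (eqcon P k) (g0 k) (g1 k)) \<and>
        (\<forall>k\<in>ineqs P i. affine_split P i (ineqcon P k) (h0 k) (h1 k)))"

definition hess_block_zero :: "'k::finite set \<Rightarrow> 'k set \<Rightarrow> (real ^ 'k \<Rightarrow> real) \<Rightarrow> real ^ 'k \<Rightarrow> bool" where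
  "hess_block_zero S T F p \<longleftrightarrow> (\<forall>k\<in>S. \<forall>l\<in>T. pd k (pd l F) p = 0)"

definition grad_block_zero :: "'k::finite set \<Rightarrow> (real ^ 'k \<Rightarrow> real) \<Rightarrow> real ^ 'k \<Rightarrow> bool" where
  "grad_block_zero S F p \<longleftrightarrow> (\<forall>k\<in>S. pd k F p = 0)"

end

theory Submission
  imports Defs
begin

text \<open>
  Each entry of \<open>Fhat P p q\<close> is a \<open>C\<^sup>2\<close> function of \<open>mix P i p q\<close> plus a \<open>C\<^sup>2\<close> function of \<open>q\<close>.
  At \<open>(ps, ps)\<close> its derivative with respect to \<open>p\<close> is block diagonal over the agents, each block
  being a local KKT matrix; it is invertible by the local regularity and strict complementarity, so
  the implicit function theorem yields the solution map. The hypotheses on the coupling terms say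
  that the derivative of \<open>Fhat\<close> with respect to \<open>q\<close> vanishes at \<open>(ps, ps)\<close>. Hence the second-order
  Taylor remainder of \<open>Fhat P (\<Phi> q) q = 0\<close> bounds \<open>\<Phi> q - ps\<close> by a multiple of the square of
  \<open>q - ps\<close>, using that \<open>\<Phi>\<close> is Lipschitz at \<open>ps\<close>.
\<close>

section \<open>Calculus of partial derivatives\<close>

text \<open>The Frechet derivative is linear, hence determined by its values on the axis vectors,
  which are the partial derivatives. All Jacobians below are handled through this coordinate
  sum.\<close>

lemma has_derivative_pd:
  fixes F :: "real ^ 'k::finite \<Rightarrow> real"
  assumes "F differentiable at p"
  shows "(F has_derivative (\<lambda>s. \<Sum>k\<in>UNIV. pd k F p * s $ k)) (at p)"
proof -
  have D: "(F has_derivative frechet_derivative F (at p)) (at p)"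
    using assms frechet_derivative_works by blast
  have "frechet_derivative F (at p) s = (\<Sum>k\<in>UNIV. pd k F p * s $ k)" for s
  proof -
    have "frechet_derivative F (at p) s = frechet_derivative F (at p) (\<Sum>k\<in>UNIV. s $ k *\<^sub>R axis k 1)"
      by (metis (no_types, lifting) basis_expansion scalar_mult_eq_scaleR sum.cong)
    also have "\<dots> = (\<Sum>k\<in>UNIV. s $ k *\<^sub>R frechet_derivative F (at p) (axis k 1))"
      using has_derivative_linear[OF D] by (simp add: linear_sum linear_scale)
    finally show ?thesis by (simp add: pd_def mult.commute)
  qed
  then show ?thesis using D by (metis (no_types, lifting) ext)
qed

lemma pd_eqI:
  assumes "(F has_derivative F') (at p)"
  shows "pd k F p = F' (axis k 1)"
  unfolding pd_def using frechet_derivative_at[OF assms] by simp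

lemma pd_const [simp]: "pd k (\<lambda>p. c) = (\<lambda>p. 0)"
  by (rule ext) (simp add: pd_def)

lemma pd_coord: "pd k (\<lambda>p. p $ l) = (\<lambda>p. if k = l then 1 else 0)"
proof
  fix p :: "real ^ 'a"
  have "((\<lambda>p. p $ l) has_derivative (\<lambda>s. s $ l)) (at p)"
    by (rule bounded_linear_imp_has_derivative) (rule bounded_linear_vec_nth)
  from pd_eqI[OF this, of k] show "pd k (\<lambda>p. p $ l) p = (if k = l then 1 else 0)"
    by (simp add: axis_def)
qed

lemma pd_add:
  assumes "F differentiable at p" "G differentiable at p"
  shows "pd k (\<lambda>p. F p + G p) p = pd k F p + pd k G p"
  using pd_eqI[OF has_derivative_add[OF assms[unfolded frechet_derivative_works]]]
  by (simp add: pd_def)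

lemma pd_mult:
  assumes "F differentiable at p" "G differentiable at p"
  shows "pd k (\<lambda>p. F p * G p) p = pd k F p * G p + F p * pd k G p"
  using pd_eqI[OF has_derivative_mult[OF assms[unfolded frechet_derivative_works]]]
  by (simp add: pd_def)

lemma Ck_Suc_differentiable: "Ck (Suc n) F \<Longrightarrow> F differentiable at p"
  by (simp add: differentiable_on_def)

lemma Ck_SucD: "Ck (Suc n) F \<Longrightarrow> Ck n F"
proof (induction n arbitrary: F)
  case 0
  then show ?case by (simp add: differentiable_imp_continuous_on)
qed auto

lemma Ck_le: "n \<le> m \<Longrightarrow> Ck m F \<Longrightarrow> Ck n F"
  by (induction m rule: dec_induct) (auto dest: Ck_SucD simp del: Ck.simps)

lemma Ck_pd: "Ck (Suc n) F \<Longrightarrow> Ck n (pd k F)"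
  by simp

lemma Ck_continuous_on: "Ck n F \<Longrightarrow> continuous_on UNIV F"
  using Ck_le[of 0 n F] by simp

lemma Ck_const: "Ck n (\<lambda>p. c)"
  by (induction n arbitrary: c) auto

lemma Ck_coord: "Ck n (\<lambda>p. p $ l)"
proof (cases n)
  case 0
  then show ?thesis by (simp add: continuous_on_component)
next
  case (Suc m)
  have "(\<lambda>p. p $ l) differentiable_on (UNIV :: (real ^ 'a) set)"
    by (rule bounded_linear_imp_differentiable_on) (rule bounded_linear_vec_nth)
  then show ?thesis by (simp add: Suc pd_coord Ck_const)
qed

lemma Ck_add: "Ck n F \<Longrightarrow> Ck n G \<Longrightarrow> Ck n (\<lambda>p. F p + G p)"
proof (induction n arbitrary: F G)
  case (Suc n)
  have "pd k (\<lambda>p. F p + G p) = (\<lambda>p. pd k F p + pd k G p)" for k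
    using Suc.prems by (intro ext pd_add) (rule Ck_Suc_differentiable, assumption)+
  then show ?case using Suc by simp
qed (simp add: continuous_on_add)

lemma Ck_mult: "Ck n F \<Longrightarrow> Ck n G \<Longrightarrow> Ck n (\<lambda>p. F p * G p)"
proof (induction n arbitrary: F G)
  case (Suc n)
  have "pd k (\<lambda>p. F p * G p) = (\<lambda>p. pd k F p * G p + F p * pd k G p)" for k
    using Suc.prems by (intro ext pd_mult) (rule Ck_Suc_differentiable, assumption)+
  then show ?case using Suc Ck_SucD[OF Suc.prems(1)] Ck_SucD[OF Suc.prems(2)]
    by (simp add: Ck_add)
qed (simp add: continuous_on_mult)

lemma Ck_sum: "(\<And>a. a \<in> A \<Longrightarrow> Ck n (F a)) \<Longrightarrow> Ck n (\<lambda>p. \<Sum>a\<in>A. F a p)"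
  by (induction A rule: infinite_finite_induct) (auto simp: Ck_const Ck_add)

lemma pd_sum:
  assumes "\<And>a. a \<in> A \<Longrightarrow> Ck (Suc n) (F a)"
  shows "pd k (\<lambda>p. \<Sum>a\<in>A. F a p) = (\<lambda>p. \<Sum>a\<in>A. pd k (F a) p)"
  using assms
proof (induction A rule: infinite_finite_induct)
  case (insert a A)
  have "pd k (\<lambda>p. F a p + (\<Sum>a\<in>A. F a p)) = (\<lambda>p. pd k (F a) p + pd k (\<lambda>p. \<Sum>a\<in>A. F a p) p)"
    using insert.prems Ck_sum[of A "Suc n" F]
    by (intro ext pd_add) (auto intro: Ck_Suc_differentiable[of n] simp del: Ck.simps)
  with insert show ?case by simp
qed auto

section \<open>Restriction to coordinate lines and symmetry of second partial derivatives\<close>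

lemma DERIV_along_axis:
  fixes F :: "real ^ 'k::finite \<Rightarrow> real"
  assumes "Ck (Suc n) F"
  shows "((\<lambda>t. F (a + t *\<^sub>R axis k 1)) has_real_derivative pd k F (a + t *\<^sub>R axis k 1)) (at t)"
proof -
  let ?D = "frechet_derivative F (at (a + t *\<^sub>R axis k 1))"
  have D: "(F has_derivative ?D) (at (a + t *\<^sub>R axis k 1))"
    using Ck_Suc_differentiable[OF assms] frechet_derivative_works by blast
  have "((\<lambda>t. a + t *\<^sub>R axis k 1) has_derivative (\<lambda>t. t *\<^sub>R axis k 1)) (at t)"
    by (auto intro!: derivative_eq_intros)
  from has_derivative_compose[OF this D] show ?thesis
    unfolding has_field_derivative_def pd_def
    by (simp add: linear_scale[OF has_derivative_linear[OF D]] mult_commute_abs)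
qed

text \<open>A move in direction \<open>k\<close> leaves all coordinates in \<open>S\<close> fixed,
  so \<open>F\<close> is constant along that line.\<close>

lemma depends_only_on_imp_pd_eq_0:
  fixes F :: "real ^ 'k::finite \<Rightarrow> real"
  assumes "depends_only_on S F" "Ck (Suc n) F" "k \<notin> S"
  shows "pd k F = (\<lambda>p. 0)"
proof
  fix p :: "real ^ 'k"
  have "(p + t *\<^sub>R axis k 1) $ j = p $ j" if "j \<in> S" for t :: real and j
    using assms(3) that by (auto simp: axis_def)
  then have "F (p + t *\<^sub>R axis k 1) = F p" for t
    using assms(1) unfolding depends_only_on_def by blast
  with DERIV_along_axis[OF assms(2), of p k 0]
  have "((\<lambda>t. F p) has_real_derivative pd k F p) (at 0)" by simp
  then show "pd k F p = 0" using DERIV_unique DERIV_const by blast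
qed

text \<open>The mean value theorem is applied twice to the second difference over a square of side
  \<open>t\<close>: in direction \<open>k\<close> to the difference of \<open>F\<close> along two
  opposite sides, then in direction \<open>l\<close> to \<open>pd k F\<close>.\<close>

lemma second_difference_eq_pd:
  fixes F :: "real ^ 'k::finite \<Rightarrow> real"
  assumes "Ck (Suc (Suc n)) F" "t > 0"
  obtains \<xi> \<eta> where "0 < \<xi>" "\<xi> < t" "0 < \<eta>" "\<eta> < t"
    "F (a + t *\<^sub>R axis k 1 + t *\<^sub>R axis l 1) - F (a + t *\<^sub>R axis k 1) - F (a + t *\<^sub>R axis l 1) + F a
       = t\<^sup>2 * pd l (pd k F) (a + \<xi> *\<^sub>R axis k 1 + \<eta> *\<^sub>R axis l 1)"
proof -
  let ?b = "a + t *\<^sub>R axis l 1"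
  let ?\<phi> = "\<lambda>s. F (?b + s *\<^sub>R axis k 1) - F (a + s *\<^sub>R axis k 1)"
  have "(?\<phi> has_real_derivative pd k F (?b + s *\<^sub>R axis k 1) - pd k F (a + s *\<^sub>R axis k 1)) (at s)" for s
    by (intro DERIV_diff DERIV_along_axis[OF assms(1)])
  from MVT2[OF assms(2) this] obtain \<xi> where \<xi>: "0 < \<xi>" "\<xi> < t"
    "?\<phi> t - ?\<phi> 0 = t * (pd k F (?b + \<xi> *\<^sub>R axis k 1) - pd k F (a + \<xi> *\<^sub>R axis k 1))"
    by auto
  let ?c = "a + \<xi> *\<^sub>R axis k 1"
  have "((\<lambda>s. pd k F (?c + s *\<^sub>R axis l 1)) has_real_derivative pd l (pd k F) (?c + s *\<^sub>R axis l 1)) (at s)" for s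
    by (rule DERIV_along_axis[OF Ck_pd[OF assms(1)]])
  from MVT2[OF assms(2) this] obtain \<eta> where \<eta>: "0 < \<eta>" "\<eta> < t"
    "pd k F (?c + t *\<^sub>R axis l 1) - pd k F (?c + 0 *\<^sub>R axis l 1) = t * pd l (pd k F) (?c + \<eta> *\<^sub>R axis l 1)"
    by auto
  have "?b + \<xi> *\<^sub>R axis k 1 = ?c + t *\<^sub>R axis l 1" "?b + t *\<^sub>R axis k 1 = a + t *\<^sub>R axis k 1 + t *\<^sub>R axis l 1"
    by (simp_all add: algebra_simps)
  with \<xi>(3) \<eta>(3) show ?thesis
    by (intro that[OF \<xi>(1,2) \<eta>(1,2)]) (simp add: power2_eq_square)
qed

text \<open>Schwarz's theorem. The second difference is symmetric in \<open>k\<close> and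
  \<open>l\<close>, so the two mixed derivatives take a common value at two points close to
  \<open>a\<close>; continuity at \<open>a\<close> then excludes a gap between them.\<close>

lemma pd_commute:
  fixes F :: "real ^ 'k::finite \<Rightarrow> real"
  assumes "Ck (Suc (Suc n)) F"
  shows "pd k (pd l F) a = pd l (pd k F) a"
proof (rule ccontr)
  assume neq: "pd k (pd l F) a \<noteq> pd l (pd k F) a"
  \<comment> \<open>Half of the supposed gap: a single number cannot be closer than \<open>e\<close>
    to both derivatives at \<open>a\<close>.\<close>
  define e where "e = \<bar>pd k (pd l F) a - pd l (pd k F) a\<bar> / 2"
  have "e > 0" using neq by (simp add: e_def)
  have cont: "isCont (pd k (pd l F)) a" "isCont (pd l (pd k F)) a"
    using Ck_continuous_on[OF Ck_pd[OF Ck_pd[OF assms]]]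
    by (simp_all add: continuous_on_eq_continuous_at)
  obtain d1 where d1: "d1 > 0" "\<And>x. dist x a < d1 \<Longrightarrow> dist (pd k (pd l F) x) (pd k (pd l F) a) < e"
    using cont(1) \<open>e > 0\<close> unfolding continuous_at_eps_delta by metis
  obtain d2 where d2: "d2 > 0" "\<And>x. dist x a < d2 \<Longrightarrow> dist (pd l (pd k F) x) (pd l (pd k F) a) < e"
    using cont(2) \<open>e > 0\<close> unfolding continuous_at_eps_delta by metis
  \<comment> \<open>An intermediate point is reached from \<open>a\<close> by two axis steps shorter
    than \<open>t\<close>, so it lies within \<open>2 * t\<close>, which is below both
    radii.\<close>
  define t where "t = min d1 d2 / 3"
  have t: "t > 0" "2 * t < d1" "2 * t < d2" using d1(1) d2(1) by (auto simp: t_def)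
  have near: "dist (a + \<xi> *\<^sub>R axis k 1 + \<eta> *\<^sub>R axis l 1) a < 2 * t"
    if "0 < \<xi>" "\<xi> < t" "0 < \<eta>" "\<eta> < t" for \<xi> \<eta> and k l :: 'k
    using that norm_triangle_ineq[of "\<xi> *\<^sub>R axis k 1" "\<eta> *\<^sub>R axis l (1::real)"]
    by (simp add: dist_norm add.assoc)
  obtain \<xi> \<eta> where 1: "0 < \<xi>" "\<xi> < t" "0 < \<eta>" "\<eta> < t"
    "F (a + t *\<^sub>R axis k 1 + t *\<^sub>R axis l 1) - F (a + t *\<^sub>R axis k 1) - F (a + t *\<^sub>R axis l 1) + F a
       = t\<^sup>2 * pd l (pd k F) (a + \<xi> *\<^sub>R axis k 1 + \<eta> *\<^sub>R axis l 1)"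
    by (rule second_difference_eq_pd[OF assms t(1)])
  obtain \<xi>' \<eta>' where 2: "0 < \<xi>'" "\<xi>' < t" "0 < \<eta>'" "\<eta>' < t"
    "F (a + t *\<^sub>R axis l 1 + t *\<^sub>R axis k 1) - F (a + t *\<^sub>R axis l 1) - F (a + t *\<^sub>R axis k 1) + F a
       = t\<^sup>2 * pd k (pd l F) (a + \<xi>' *\<^sub>R axis l 1 + \<eta>' *\<^sub>R axis k 1)"
    by (rule second_difference_eq_pd[OF assms t(1)])
  have "t\<^sup>2 * pd l (pd k F) (a + \<xi> *\<^sub>R axis k 1 + \<eta> *\<^sub>R axis l 1)
      = t\<^sup>2 * pd k (pd l F) (a + \<xi>' *\<^sub>R axis l 1 + \<eta>' *\<^sub>R axis k 1)"
    unfolding 1(5)[symmetric] 2(5)[symmetric] by (simp add: add.commute add.left_commute)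
  then have "pd l (pd k F) (a + \<xi> *\<^sub>R axis k 1 + \<eta> *\<^sub>R axis l 1)
      = pd k (pd l F) (a + \<xi>' *\<^sub>R axis l 1 + \<eta>' *\<^sub>R axis k 1)"
    using t(1) by simp
  moreover have "dist (pd l (pd k F) (a + \<xi> *\<^sub>R axis k 1 + \<eta> *\<^sub>R axis l 1)) (pd l (pd k F) a) < e"
    using less_trans[OF near[OF 1(1-4)] t(3)] by (intro d2(2))
  moreover have "dist (pd k (pd l F) (a + \<xi>' *\<^sub>R axis l 1 + \<eta>' *\<^sub>R axis k 1)) (pd k (pd l F) a) < e"
    using less_trans[OF near[OF 2(1-4)] t(2)] by (intro d1(2))
  ultimately show False by (auto simp: e_def dist_real_def abs_if split: if_splits)
qed

section \<open>Estimates at a point: Lipschitz bound and quadratic Taylor remainder\<close>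

lemma has_derivative_imp_locally_Lipschitz:
  fixes f :: "'a::real_normed_vector \<Rightarrow> 'b::real_normed_vector"
  assumes "(f has_derivative f') (at a)"
  obtains K d where "K > 0" "d > 0" "\<And>x. x \<in> ball a d \<Longrightarrow> norm (f x - f a) \<le> K * norm (x - a)"
proof -
  obtain B where B: "\<And>x. norm (f' x) \<le> norm x * B" "B > 0"
    using bounded_linear.pos_bounded[OF has_derivative_bounded_linear[OF assms]] by metis
  \<comment> \<open>Differentiability is taken with error factor 1, so the Lipschitz constant
    becomes \<open>B + 1\<close>. One endpoint stays at \<open>a\<close>; differentiability at that
    single point suffices.\<close>
  obtain d where d: "d > 0" "\<And>x. norm (x - a) < d \<Longrightarrow> norm (f x - f a - f' (x - a)) \<le> 1 * norm (x - a)"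
    using assms unfolding has_derivative_at_alt by (metis zero_less_one)
  show ?thesis
  proof (rule that[of "B + 1" d])
    fix x assume "x \<in> ball a d"
    then have "norm (x - a) < d" by (simp add: dist_norm norm_minus_commute)
    with d(2)[of x] B(1)[of "x - a"] norm_triangle_ineq[of "f x - f a - f' (x - a)" "f' (x - a)"]
    show "norm (f x - f a) \<le> (B + 1) * norm (x - a)" by (simp add: algebra_simps)
  qed (use B d in auto)
qed

text \<open>The first partial derivatives are differentiable, hence Lipschitz at \<open>a\<close>.
  On the segment from \<open>a\<close> to \<open>z\<close> the derivative therefore deviates from
  the one at \<open>a\<close> by a multiple of \<open>norm (z - a)\<close>, and the mean value
  inequality contributes the second such factor.\<close>

lemma Ck2_quadratic_remainder:
  fixes F :: "real ^ 'k::finite \<Rightarrow> real"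
  assumes "Ck (Suc (Suc n)) F"
  obtains C d where "C > 0" "d > 0"
    "\<And>z. z \<in> ball a d \<Longrightarrow> \<bar>F z - F a - (\<Sum>k\<in>UNIV. pd k F a * (z - a) $ k)\<bar> \<le> C * (norm (z - a))\<^sup>2"
proof -
  have "\<exists>K d. K > 0 \<and> d > 0 \<and> (\<forall>x\<in>ball a d. norm (pd k F x - pd k F a) \<le> K * norm (x - a))" for k
    using has_derivative_imp_locally_Lipschitz[OF has_derivative_pd[OF Ck_Suc_differentiable[OF Ck_pd[OF assms]]], of a k]
    by metis
  then obtain K d where Kd: "\<And>k. K k > 0" "\<And>k. d k > 0"
    "\<And>k x. x \<in> ball a (d k) \<Longrightarrow> norm (pd k F x - pd k F a) \<le> K k * norm (x - a)"
    by metis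
  define e where "e = Min (range d)"
  have e: "e > 0" "\<And>k. e \<le> d k" using Kd(2) by (auto simp: e_def)
  define C where "C = (\<Sum>k\<in>UNIV. K k)"
  have "C > 0" using Kd(1) by (auto simp: C_def intro!: sum_pos)
  show ?thesis
  proof (rule that[OF \<open>C > 0\<close> e(1)])
    fix z assume z: "z \<in> ball a e"
    \<comment> \<open>The closed ball contains the segment from \<open>a\<close> to
      \<open>z\<close>, yet is no larger than the distance in which the remainder is
      measured.\<close>
    let ?S = "cball a (norm (z - a))"
    let ?F' = "\<lambda>x s. \<Sum>k\<in>UNIV. pd k F x * s $ k"
    have sub: "?S \<subseteq> ball a (d k)" for k
      using z e(2)[of k] by (auto simp: dist_norm norm_minus_commute)
    have "norm (F z - F a - ?F' a (z - a)) \<le> norm (z - a) * (C * norm (z - a))"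
    proof (rule differentiable_bound_linearization[where S = ?S and f' = ?F'])
      show "a + t *\<^sub>R (z - a) \<in> ?S" if "t \<in> {0..1}" for t
        using that by (simp add: dist_norm mult_left_le_one_le)
      show "(F has_derivative ?F' x) (at x within ?S)" for x
        by (rule has_derivative_at_withinI[OF has_derivative_pd[OF Ck_Suc_differentiable[OF assms]]])
      show "onorm (?F' x - ?F' a) \<le> C * norm (z - a)" if x: "x \<in> ?S" for x
      proof (rule onorm_le)
        fix s :: "real ^ 'k"
        have "norm ((?F' x - ?F' a) s) = \<bar>\<Sum>k\<in>UNIV. (pd k F x - pd k F a) * s $ k\<bar>"
          by (simp add: sum_subtractf left_diff_distrib)
        also have "\<dots> \<le> (\<Sum>k\<in>UNIV. \<bar>(pd k F x - pd k F a) * s $ k\<bar>)"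
          by (rule sum_abs)
        also have "\<dots> \<le> (\<Sum>k\<in>UNIV. K k * norm (z - a) * norm s)"
        proof (rule sum_mono)
          fix k
          have "\<bar>pd k F x - pd k F a\<bar> \<le> K k * norm (x - a)"
            using Kd(3)[of x k] sub[of k] x by auto
          also have "\<dots> \<le> K k * norm (z - a)"
            using x Kd(1)[of k] by (auto simp: dist_norm norm_minus_commute intro!: mult_left_mono)
          finally show "\<bar>(pd k F x - pd k F a) * s $ k\<bar> \<le> K k * norm (z - a) * norm s"
            by (simp add: abs_mult mult_mono component_le_norm_cart)
        qed
        finally show "norm ((?F' x - ?F' a) s) \<le> C * norm (z - a) * norm s"
          by (simp add: C_def sum_distrib_right)
      qed
    qed simp
    then show "\<bar>F z - F a - (\<Sum>k\<in>UNIV. pd k F a * (z - a) $ k)\<bar> \<le> C * (norm (z - a))\<^sup>2"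
      by (simp add: power2_eq_square algebra_simps)
  qed
qed

section \<open>A continuously differentiable implicit function\<close>

text \<open>The resolvent-type identity \<open>B y - B y0 = - B y (A y - A y0) B y0\<close> reduces
  continuity of the inverse to a bound on \<open>B y\<close> for \<open>y\<close> near
  \<open>y0\<close>.\<close>

lemma continuous_on_blinfun_inverse:
  fixes A :: "'a::topological_space \<Rightarrow> ('b::real_normed_vector \<Rightarrow>\<^sub>L 'b)"
  assumes A: "continuous_on S A"
    and left: "\<And>y. y \<in> S \<Longrightarrow> B y o\<^sub>L A y = id_blinfun"
    and right: "\<And>y. y \<in> S \<Longrightarrow> A y o\<^sub>L B y = id_blinfun"
  shows "continuous_on S B"
  unfolding continuous_on_def
proof
  fix y0 assume y0: "y0 \<in> S"
  let ?b = "norm (B y0)"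
  have lim: "((\<lambda>y. norm (A y - A y0)) \<longlongrightarrow> 0) (at y0 within S)"
    using A y0 unfolding continuous_on_def by (metis Lim_null tendsto_norm_zero)
  have ev: "eventually (\<lambda>y. y \<in> S) (at y0 within S)"
    by (simp add: eventually_at_filter)
  have diff: "norm (B y - B y0) \<le> norm (B y) * norm (A y - A y0) * ?b" if "y \<in> S" for y
  proof -
    have "blinfun_apply (B y) (blinfun_apply (A y) v) = v"
      "blinfun_apply (A y0) (blinfun_apply (B y0) v) = v" for v
      using left[OF that] right[OF y0]
      by (metis blinfun_apply_blinfun_compose blinfun_apply_id_blinfun)+
    then have "B y - B y0 = - (B y o\<^sub>L (A y - A y0) o\<^sub>L B y0)"
      by (intro blinfun_eqI) (simp add: blinfun.bilinear_simps)
    moreover have "norm (B y o\<^sub>L (A y - A y0) o\<^sub>L B y0) \<le> norm (B y) * norm (A y - A y0) * ?b"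
      by (meson norm_blinfun_compose mult_right_mono norm_ge_zero order_trans)
    ultimately show ?thesis by simp
  qed
  \<comment> \<open>With the bound 1/2 the term \<open>norm (B y) / 2\<close> can be absorbed on the
    left, giving \<open>norm (B y) \<le> 2 * ?b\<close>.\<close>
  have "eventually (\<lambda>y. norm (A y - A y0) * ?b < 1 / 2) (at y0 within S)"
    using tendsto_mult_left_zero[OF lim, of ?b] by (rule order_tendstoD) simp
  with ev have bound: "eventually (\<lambda>y. norm (B y - B y0) \<le> 2 * ?b * ?b * norm (A y - A y0)) (at y0 within S)"
  proof eventually_elim
    case (elim y)
    have "norm (B y - B y0) \<le> norm (B y) * (1 / 2)"
      using diff[OF elim(1)] mult_left_mono[of "norm (A y - A y0) * ?b" "1/2" "norm (B y)"] elim(2)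
      by (simp add: mult.assoc)
    with norm_triangle_ineq[of "B y - B y0" "B y0"] have "norm (B y) \<le> 2 * ?b" by simp
    then have "norm (B y) * norm (A y - A y0) * ?b \<le> 2 * ?b * norm (A y - A y0) * ?b"
      by (intro mult_right_mono) auto
    with diff[OF elim(1)] show ?case by (simp add: mult_ac)
  qed
  have "((\<lambda>y. 2 * ?b * ?b * norm (A y - A y0)) \<longlongrightarrow> 0) (at y0 within S)"
    by (rule tendsto_mult_right_zero[OF lim])
  from Lim_null_comparison[OF bound this] show "(B \<longlongrightarrow> B y0) (at y0 within S)"
    by (rule LIM_zero_cancel)
qed

text \<open>The inverse function theorem is applied to
  \<open>(p, q) \<mapsto> (F (p, q), q)\<close>; with \<open>g\<close> its local inverse, the
  implicit function is \<open>q \<mapsto> fst (g (0, q))\<close>. Uniqueness is stated on a full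
  box, the form needed for local uniqueness of KKT solutions.\<close>

lemma implicit_function_C1:
  fixes F :: "'a::euclidean_space \<times> 'b::euclidean_space \<Rightarrow> 'a"
  assumes "open W" "(p0, q0) \<in> W"
    and derF: "\<And>z. z \<in> W \<Longrightarrow> (F has_derivative blinfun_apply (F' z)) (at z)"
    and contF': "continuous_on W F'"
    and F0: "F (p0, q0) = 0"
    and inj: "\<And>s. blinfun_apply (F' (p0, q0)) (s, 0) = 0 \<Longrightarrow> s = 0"
  obtains \<Phi> \<Phi>' \<delta> \<epsilon> where "\<delta> > 0" "\<epsilon> > 0" "ball p0 \<epsilon> \<times> ball q0 \<delta> \<subseteq> W" "\<Phi> q0 = p0"
    "\<And>q. q \<in> ball q0 \<delta> \<Longrightarrow> (\<Phi> has_derivative blinfun_apply (\<Phi>' q)) (at q)"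
    "continuous_on (ball q0 \<delta>) \<Phi>'"
    "\<And>q. q \<in> ball q0 \<delta> \<Longrightarrow> \<Phi> q \<in> ball p0 \<epsilon> \<and> F (\<Phi> q, q) = 0"
    "\<And>p q. p \<in> ball p0 \<epsilon> \<Longrightarrow> q \<in> ball q0 \<delta> \<Longrightarrow> F (p, q) = 0 \<Longrightarrow> p = \<Phi> q"
proof -
  define pair where "pair L = Blinfun (\<lambda>z. (blinfun_apply L z, snd z))"
    for L :: "('a \<times> 'b) \<Rightarrow>\<^sub>L 'a"
  have pair: "blinfun_apply (pair L) z = (blinfun_apply L z, snd z)" for L z
    unfolding pair_def by (subst bounded_linear_Blinfun_apply) (auto intro!: bounded_linear_intros)
  let ?H = "\<lambda>z. (F z, snd z)"
  have derH: "(?H has_derivative blinfun_apply (pair (F' z))) (at z)" if "z \<in> W" for z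
    using derF[OF that] by (auto simp: pair[abs_def] intro!: derivative_eq_intros)
  have contH: "continuous_on W (\<lambda>z. pair (F' z))"
    by (intro continuous_blinfun_componentwiseI continuous_on_blinfun_componentwise)
      (auto simp: pair intro!: continuous_intros contF')
  \<comment> \<open>A vector in the kernel has second component zero, and then \<open>inj\<close>
    makes the first one vanish. The resulting left inverse is how the inverse function theorem
    receives invertibility.\<close>
  have "inj (blinfun_apply (pair (F' (p0, q0))))"
  proof (rule linear_injective_0[THEN iffD2, OF bounded_linear.linear[OF blinfun.bounded_linear_right]], intro allI impI)
    fix z assume "blinfun_apply (pair (F' (p0, q0))) z = 0"
    then show "z = 0" using inj[of "fst z"] by (cases z) (auto simp: pair zero_prod_def)
  qed
  then obtain h where h: "linear h" "h \<circ> blinfun_apply (pair (F' (p0, q0))) = id"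
    using linear_injective_left_inverse[OF bounded_linear.linear[OF blinfun.bounded_linear_right]] by blast
  have invf: "Blinfun h o\<^sub>L pair (F' (p0, q0)) = id_blinfun"
    using bounded_linear_Blinfun_apply[of h] h
    by (intro blinfun_eqI) (auto simp: linear_conv_bounded_linear dest: pointfree_idE)
  obtain U V g g' where U: "open U" "U \<subseteq> W" "(p0, q0) \<in> U"
    and V: "open V" "?H (p0, q0) \<in> V" and hom: "homeomorphism U V ?H g"
    and g: "\<And>y. y \<in> V \<Longrightarrow> (g has_derivative g' y) (at y)"
    and g': "\<And>y. y \<in> V \<Longrightarrow> g' y = inv (blinfun_apply (pair (F' (g y))))"
    and bij: "\<And>y. y \<in> V \<Longrightarrow> bij (blinfun_apply (pair (F' (g y))))"
    by (rule inverse_function_theorem[OF assms(1) derH contH assms(2) invf]) (assumption | blast)+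
  have gU: "g y \<in> U" "F (g y) = fst y" "snd (g y) = snd y" if "y \<in> V" for y
    using homeomorphism_image2[OF hom] homeomorphism_apply2[OF hom that] that
    by (auto simp: prod_eq_iff)
  have gH: "g (?H z) = z" "?H z \<in> V" if "z \<in> U" for z
    using homeomorphism_image1[OF hom] homeomorphism_apply1[OF hom that] that by auto
  have contg: "continuous_on V g" using hom by (simp add: homeomorphism_def)
  \<comment> \<open>The theorem gives the derivative of \<open>g\<close> only pointwise, as an
    inverse map; bundled as \<open>G\<close> it is continuous by the lemma on operator
    inverses.\<close>
  define G where "G y = Blinfun (g' y)" for y
  have G: "blinfun_apply (G y) = g' y" if "y \<in> V" for y
    unfolding G_def using g[OF that] bounded_linear_Blinfun_apply has_derivative_bounded_linear by blast
  have contG: "continuous_on V G"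
  proof (rule continuous_on_blinfun_inverse)
    show "continuous_on V (\<lambda>y. pair (F' (g y)))"
      using gU(1) U(2) by (intro continuous_on_compose2[OF contH contg]) blast
    show "G y o\<^sub>L pair (F' (g y)) = id_blinfun" if "y \<in> V" for y
      using bij[OF that] by (intro blinfun_eqI) (simp add: G that g' bij_is_inj inv_f_f)
    show "pair (F' (g y)) o\<^sub>L G y = id_blinfun" if "y \<in> V" for y
      using bij[OF that] by (intro blinfun_eqI) (simp add: G that g' bij_is_surj surj_f_inv_f)
  qed
  \<comment> \<open>On a box inside \<open>U\<close> the map \<open>?H\<close> is undone by
    \<open>g\<close>, so a zero \<open>(p, q)\<close> of \<open>F\<close> there must equal
    \<open>g (0, q)\<close>.\<close>
  obtain A B where AB: "open A" "open B" "(p0, q0) \<in> A \<times> B" "A \<times> B \<subseteq> U"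
    by (rule open_prod_elim[OF U(1) U(3)])
  then have "p0 \<in> A" "q0 \<in> B" by auto
  obtain e1 where e1: "e1 > 0" "ball p0 e1 \<subseteq> A" by (rule openE[OF AB(1) \<open>p0 \<in> A\<close>])
  obtain e2 where e2: "e2 > 0" "ball q0 e2 \<subseteq> B" by (rule openE[OF AB(2) \<open>q0 \<in> B\<close>])
  define \<epsilon> where "\<epsilon> = min e1 e2"
  have "\<epsilon> > 0" "ball p0 \<epsilon> \<subseteq> A" "ball q0 \<epsilon> \<subseteq> B" using e1 e2 by (auto simp: \<epsilon>_def)
  with AB(4) have \<epsilon>: "\<epsilon> > 0" "ball p0 \<epsilon> \<times> ball q0 \<epsilon> \<subseteq> U" by blast+
  have 0: "(0, q0) \<in> V" using V(2) F0 by simp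
  have g0: "g (0, q0) = (p0, q0)" using gH(1)[OF U(3)] F0 by simp
  let ?e = "\<lambda>q::'b. (0::'a, q)"
  have "open (?e -` V)"
    by (rule open_vimage[OF V(1)]) (intro continuous_intros)
  moreover have conte: "continuous_on (?e -` V) (\<lambda>q. fst (g (?e q)))"
    by (intro continuous_intros continuous_on_compose2[OF contg]) auto
  ultimately have "open (?e -` V \<inter> (\<lambda>q. fst (g (?e q))) -` ball p0 \<epsilon>)"
    using continuous_open_preimage open_ball by blast
  moreover have "q0 \<in> ?e -` V \<inter> (\<lambda>q. fst (g (?e q))) -` ball p0 \<epsilon>"
    using 0 g0 \<epsilon> by simp
  \<comment> \<open>The parameter radius is chosen so that the implicit function is defined and
    stays in the ball on which uniqueness holds.\<close>
  ultimately obtain \<delta>0 where \<delta>0: "\<delta>0 > 0"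
    "ball q0 \<delta>0 \<subseteq> ?e -` V \<inter> (\<lambda>q. fst (g (?e q))) -` ball p0 \<epsilon>"
    by (rule openE)
  define \<delta> where "\<delta> = min \<delta>0 \<epsilon>"
  have \<delta>: "\<delta> > 0" "ball q0 \<delta> \<subseteq> ball q0 \<epsilon>"
    "\<And>q. q \<in> ball q0 \<delta> \<Longrightarrow> ?e q \<in> V \<and> fst (g (?e q)) \<in> ball p0 \<epsilon>"
    using \<delta>0 \<epsilon> by (auto simp: \<delta>_def)
  let ?\<Phi> = "\<lambda>q. fst (g (?e q))"
  let ?inr = "Blinfun ?e :: 'b \<Rightarrow>\<^sub>L ('a \<times> 'b)"
  have inr: "blinfun_apply ?inr = ?e"
    by (rule bounded_linear_Blinfun_apply) (intro bounded_linear_intros)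
  show ?thesis
  proof (rule that[of \<delta> \<epsilon> ?\<Phi> "\<lambda>q. fst_blinfun o\<^sub>L G (?e q) o\<^sub>L ?inr"])
    show "ball p0 \<epsilon> \<times> ball q0 \<delta> \<subseteq> W"
      using \<epsilon>(2) U(2) \<delta>(2) by blast
    show "(?\<Phi> has_derivative blinfun_apply (fst_blinfun o\<^sub>L G (?e q) o\<^sub>L ?inr)) (at q)"
      if "q \<in> ball q0 \<delta>" for q
    proof -
      have V: "?e q \<in> V" using \<delta>(3)[OF that] by blast
      have "(?e has_derivative ?e) (at q)" by (auto intro!: derivative_eq_intros)
      note has_derivative_fst[OF has_derivative_compose[OF this g[OF V]]]
      moreover have "blinfun_apply (fst_blinfun o\<^sub>L G (?e q) o\<^sub>L ?inr) = (\<lambda>t. fst (g' (?e q) (?e t)))"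
        by (rule ext) (simp add: G[OF V] inr)
      ultimately show ?thesis by simp
    qed
    show "continuous_on (ball q0 \<delta>) (\<lambda>q. fst_blinfun o\<^sub>L G (?e q) o\<^sub>L ?inr)"
      using \<delta>(3) by (intro continuous_intros continuous_on_compose2[OF contG]) auto
    show "?\<Phi> q \<in> ball p0 \<epsilon> \<and> F (?\<Phi> q, q) = 0" if "q \<in> ball q0 \<delta>" for q
    proof -
      have q: "?e q \<in> V" "?\<Phi> q \<in> ball p0 \<epsilon>" using \<delta>(3)[OF that] by auto
      have "g (?e q) = (?\<Phi> q, q)" using gU(3)[OF q(1)] by (simp add: prod_eq_iff)
      with gU(2)[OF q(1)] q(2) show ?thesis by simp
    qed
    show "p = ?\<Phi> q" if "p \<in> ball p0 \<epsilon>" "q \<in> ball q0 \<delta>" "F (p, q) = 0" for p q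
    proof -
      have "(p, q) \<in> U" using that(1,2) \<epsilon>(2) \<delta>(2) by blast
      from gH(1)[OF this] that(3) show ?thesis by simp
    qed
  qed (use \<delta> \<epsilon> g0 in auto)
qed

section \<open>The local KKT residual\<close>

lemma pd_coord_mult:
  fixes H :: "real ^ 'k::finite \<Rightarrow> real"
  assumes "Ck (Suc n) H"
  shows "pd l (\<lambda>p. p $ e * H p) = (\<lambda>p. (if l = e then H p else 0) + p $ e * pd l H p)"
proof
  fix p :: "real ^ 'k"
  have "(\<lambda>p. p $ e) differentiable at p"
    by (rule Ck_Suc_differentiable[OF Ck_coord])
  from pd_mult[OF this Ck_Suc_differentiable[OF assms], of l]
  show "pd l (\<lambda>p. p $ e * H p) p = (if l = e then H p else 0) + p $ e * pd l H p"
    by (simp add: pd_coord)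
qed

lemma pd_weighted_sum:
  assumes "\<And>e. e \<in> E \<Longrightarrow> Ck (Suc n) (H e)"
  shows "pd l (\<lambda>p. \<Sum>e\<in>E. p $ e * H e p)
    = (\<lambda>p. \<Sum>e\<in>E. (if l = e then H e p else 0) + p $ e * pd l (H e) p)"
proof -
  have "pd l (\<lambda>p. \<Sum>e\<in>E. p $ e * H e p) = (\<lambda>p. \<Sum>e\<in>E. pd l (\<lambda>p. p $ e * H e p) p)"
    by (rule pd_sum[where n = n]) (intro Ck_mult Ck_coord assms)
  then show ?thesis
    using pd_coord_mult[OF assms] by (simp cong: sum.cong)
qed

lemma pd_weighted_sums:
  assumes "Ck (Suc n) C" "\<And>e. e \<in> E \<Longrightarrow> Ck (Suc n) (G e)" "\<And>e. e \<in> I \<Longrightarrow> Ck (Suc n) (H e)"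
  shows "pd l (\<lambda>p. C p + (\<Sum>e\<in>E. p $ e * G e p) + (\<Sum>e\<in>I. p $ e * H e p))
    = (\<lambda>p. pd l C p
        + (\<Sum>e\<in>E. (if l = e then G e p else 0) + p $ e * pd l (G e) p)
        + (\<Sum>e\<in>I. (if l = e then H e p else 0) + p $ e * pd l (H e) p))"
proof
  fix p
  have E: "Ck (Suc n) (\<lambda>p. \<Sum>e\<in>E. p $ e * G e p)" and I: "Ck (Suc n) (\<lambda>p. \<Sum>e\<in>I. p $ e * H e p)"
    by (intro Ck_sum Ck_mult Ck_coord assms; assumption)+
  note d = Ck_Suc_differentiable
  show "pd l (\<lambda>p. C p + (\<Sum>e\<in>E. p $ e * G e p) + (\<Sum>e\<in>I. p $ e * H e p)) p
    = pd l C p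
        + (\<Sum>e\<in>E. (if l = e then G e p else 0) + p $ e * pd l (G e) p)
        + (\<Sum>e\<in>I. (if l = e then H e p else 0) + p $ e * pd l (H e) p)"
    using pd_add[OF d[OF Ck_add[OF assms(1) E]] d[OF I], of l p] pd_add[OF d[OF assms(1)] d[OF E], of l p]
      fun_cong[OF pd_weighted_sum[of E n G l, OF assms(2)], of p]
      fun_cong[OF pd_weighted_sum[of I n H l, OF assms(3)], of p]
    by simp
qed

lemma nlp_Ck:
  assumes "central_nlp P"
  shows "Ck 3 (cost P i)" "e \<in> eqs P i \<Longrightarrow> Ck 3 (eqcon P e)" "e \<in> ineqs P i \<Longrightarrow> Ck 3 (ineqcon P e)"
  using assms unfolding central_nlp_def by blast+

lemma nlp_depends:
  assumes "central_nlp P"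
  shows "depends_only_on (nbhd_prims P i) (cost P i)"
    "e \<in> eqs P i \<Longrightarrow> depends_only_on (nbhd_prims P i) (eqcon P e)"
    "e \<in> ineqs P i \<Longrightarrow> depends_only_on (nbhd_prims P i) (ineqcon P e)"
  using assms unfolding central_nlp_def by blast+

lemmas nlp_Ck3 = nlp_Ck[unfolded numeral_3_eq_3]

lemma nlp_pd_eq_0:
  assumes "central_nlp P" "k \<notin> nbhd_prims P i"
  shows "pd k (cost P i) = (\<lambda>p. 0)"
    "e \<in> eqs P i \<Longrightarrow> pd k (eqcon P e) = (\<lambda>p. 0)"
    "e \<in> ineqs P i \<Longrightarrow> pd k (ineqcon P e) = (\<lambda>p. 0)"
  using depends_only_on_imp_pd_eq_0[OF nlp_depends(1) nlp_Ck3(1)]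
    depends_only_on_imp_pd_eq_0[OF nlp_depends(2) nlp_Ck3(2)]
    depends_only_on_imp_pd_eq_0[OF nlp_depends(3) nlp_Ck3(3)] assms by blast+

lemma Ck_lagr:
  assumes "central_nlp P"
  shows "Ck (Suc (Suc (Suc 0))) (lagr P i)"
  unfolding lagr_def by (intro Ck_add Ck_sum Ck_mult Ck_coord nlp_Ck3; (rule assms | assumption))

lemma pd_lagr:
  assumes "central_nlp P"
  shows "pd k (lagr P i) = (\<lambda>p. pd k (cost P i) p
     + (\<Sum>e\<in>eqs P i. (if k = e then eqcon P e p else 0) + p $ e * pd k (eqcon P e) p)
     + (\<Sum>e\<in>ineqs P i. (if k = e then ineqcon P e p else 0) + p $ e * pd k (ineqcon P e) p))"
  unfolding lagr_def
  by (rule pd_weighted_sums) (blast intro: nlp_Ck3 assms)+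

lemma pd_lagr_Primal:
  assumes "central_nlp P" "kind P k = Primal"
  shows "pd k (lagr P i) = (\<lambda>p. pd k (cost P i) p
     + (\<Sum>e\<in>eqs P i. p $ e * pd k (eqcon P e) p)
     + (\<Sum>e\<in>ineqs P i. p $ e * pd k (ineqcon P e) p))"
proof -
  have "k \<noteq> e" if "e \<in> eqs P i \<or> e \<in> ineqs P i" for e
    using assms(2) that by (auto simp: eqs_def ineqs_def)
  then show ?thesis by (simp add: pd_lagr[OF assms(1)] cong: sum.cong)
qed

text \<open>The coordinate \<open>l\<close> may itself be a multiplier. The \<open>if\<close> terms
  then yield the constraint gradients, the off-diagonal blocks of the KKT matrix.\<close>

lemma pd_pd_lagr_Primal:
  assumes "central_nlp P" "kind P k = Primal"
  shows "pd l (pd k (lagr P i)) p = pd l (pd k (cost P i)) p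
     + (\<Sum>e\<in>eqs P i. (if l = e then pd k (eqcon P e) p else 0) + p $ e * pd l (pd k (eqcon P e)) p)
     + (\<Sum>e\<in>ineqs P i. (if l = e then pd k (ineqcon P e) p else 0) + p $ e * pd l (pd k (ineqcon P e)) p)"
  unfolding pd_lagr_Primal[OF assms]
  by (rule pd_weighted_sums[THEN fun_cong]) (blast intro: Ck_pd nlp_Ck3 assms)+

section \<open>Mixed points and the derivative of the residual\<close>

lemma mix_self [simp]: "mix P i p p = p"
  by (simp add: mix_def vec_eq_iff)

lemma mix_diff: "mix P i p q - mix P i p' q' = mix P i (p - p') (q - q')"
  by (simp add: mix_def vec_eq_iff)

lemma mix_add: "mix P i (p + p') (q + q') = mix P i p q + mix P i p' q'"
  by (simp add: mix_def vec_eq_iff)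

lemma mix_scaleR: "mix P i (c *\<^sub>R p) (c *\<^sub>R q) = c *\<^sub>R mix P i p q"
  by (simp add: mix_def vec_eq_iff)

lemma linear_mix: "linear (\<lambda>z. mix P i (fst z) (snd z))"
  by (rule linearI) (simp_all add: mix_add mix_scaleR)

lemma norm_mix_le: "norm (mix P i p q) \<le> norm p + norm q"
proof -
  have "mix P i p q = mix P i p 0 + mix P i 0 q" by (simp add: mix_def vec_eq_iff)
  moreover have "norm (mix P i p 0) \<le> norm p" "norm (mix P i 0 q) \<le> norm q"
    by (rule norm_le_componentwise_cart, simp add: mix_def)+
  ultimately show ?thesis using norm_triangle_mono by metis
qed

lemma continuous_on_mix: "continuous_on S (\<lambda>z. mix P i (fst z) (snd z))"
  using linear_mix linear_continuous_on linear_conv_bounded_linear by blast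

text \<open>Together with \<open>coupling_part\<close> this separates an entry of
  \<open>Fhat\<close> into functions of one stacked vector. The pair \<open>(p, q)\<close> enters
  the own part only through the linear map \<open>mix\<close>, so partial derivatives on a single
  space suffice.\<close>

definition own_part :: "('v::finite, 'k::finite) nlp \<Rightarrow> 'k \<Rightarrow> real ^ 'k \<Rightarrow> real" where
  "own_part P k = (case kind P k of
      Primal \<Rightarrow> pd k (lagr P (agent P k))
    | Eq_Mult \<Rightarrow> eqcon P k
    | Ineq_Mult \<Rightarrow> (\<lambda>p. p $ k * ineqcon P k p))"

definition coupling_part :: "('v::finite, 'k::finite) nlp \<Rightarrow> 'k \<Rightarrow> real ^ 'k \<Rightarrow> real" where
  "coupling_part P k = (case kind P k of
      Primal \<Rightarrow> (\<lambda>q. \<Sum>j\<in>nbrs P (agent P k). pd k (lagr P j) q)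
    | _ \<Rightarrow> (\<lambda>q. 0))"

lemma Fhat_nth: "Fhat P p q $ k = own_part P k (mix P (agent P k) p q) + coupling_part P k q"
  by (auto simp: Fhat_def own_part_def coupling_part_def mix_def Let_def split: coord_kind.split)

lemma kind_cases:
  obtains "kind P k = Primal" "k \<in> prims P (agent P k)"
  | "kind P k = Eq_Mult" "k \<in> eqs P (agent P k)"
  | "kind P k = Ineq_Mult" "k \<in> ineqs P (agent P k)"
  by (cases "kind P k") (auto simp: prims_def eqs_def ineqs_def)

text \<open>The primal rows already contain one derivative, so three times differentiable data leave
  two orders of smoothness for the Taylor estimate.\<close>

lemma Ck_own_part:
  assumes "central_nlp P"
  shows "Ck (Suc (Suc 0)) (own_part P k)"
  by (cases P k rule: kind_cases)
    (auto simp: own_part_def simp del: Ck.simps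
      intro!: Ck_mult Ck_coord Ck_pd Ck_lagr assms Ck_SucD[OF nlp_Ck3(2)] Ck_SucD[OF nlp_Ck3(3)])

lemma Ck_coupling_part:
  assumes "central_nlp P"
  shows "Ck (Suc (Suc 0)) (coupling_part P k)"
  by (auto simp: coupling_part_def simp del: Ck.simps split: coord_kind.split
      intro!: Ck_const Ck_sum Ck_pd Ck_lagr assms)

text \<open>The chain rule through \<open>mix\<close> and \<open>snd\<close>, bundled as a bounded
  linear map because the implicit function lemma asks for continuity in operator norm.\<close>

definition Fhat_deriv :: "('v::finite, 'k::finite) nlp \<Rightarrow> (real ^ 'k) \<times> (real ^ 'k) \<Rightarrow>
    ((real ^ 'k) \<times> (real ^ 'k)) \<Rightarrow>\<^sub>L (real ^ 'k)" where
  "Fhat_deriv P z = Blinfun (\<lambda>w. \<chi> k.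
     (\<Sum>l\<in>UNIV. pd l (own_part P k) (mix P (agent P k) (fst z) (snd z)) * mix P (agent P k) (fst w) (snd w) $ l)
     + (\<Sum>l\<in>UNIV. pd l (coupling_part P k) (snd z) * snd w $ l))"

lemma Fhat_deriv_apply:
  "blinfun_apply (Fhat_deriv P z) w = (\<chi> k.
     (\<Sum>l\<in>UNIV. pd l (own_part P k) (mix P (agent P k) (fst z) (snd z)) * mix P (agent P k) (fst w) (snd w) $ l)
     + (\<Sum>l\<in>UNIV. pd l (coupling_part P k) (snd z) * snd w $ l))"
  unfolding Fhat_deriv_def
  by (subst bounded_linear_Blinfun_apply)
    (auto intro!: linearI simp: linear_conv_bounded_linear[symmetric] vec_eq_iff mix_add mix_scaleR
      algebra_simps sum.distrib sum_distrib_left)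

lemma has_derivative_Fhat:
  assumes "central_nlp P"
  shows "((\<lambda>z. Fhat P (fst z) (snd z)) has_derivative blinfun_apply (Fhat_deriv P z)) (at z)"
proof (subst has_derivative_componentwise_within, intro ballI)
  fix b :: "real ^ 'b" assume "b \<in> Basis"
  then obtain k where b: "b = axis k 1" by (auto simp: Basis_vec_def)
  have mix: "((\<lambda>z. mix P i (fst z) (snd z)) has_derivative (\<lambda>w. mix P i (fst w) (snd w))) (at z)" for i
    using linear_mix bounded_linear_imp_has_derivative linear_conv_bounded_linear by blast
  have snd: "(snd has_derivative snd) (at z)"
    by (rule bounded_linear_imp_has_derivative) (rule bounded_linear_snd)
  have own: "(own_part P k has_derivative (\<lambda>s. \<Sum>l\<in>UNIV. pd l (own_part P k) p * s $ l)) (at p)"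
    and coupling: "(coupling_part P k has_derivative (\<lambda>s. \<Sum>l\<in>UNIV. pd l (coupling_part P k) p * s $ l)) (at p)" for p
    using Ck_own_part[OF assms] Ck_coupling_part[OF assms] has_derivative_pd Ck_Suc_differentiable by blast+
  from has_derivative_add[OF has_derivative_compose[OF mix own] has_derivative_compose[OF snd coupling]]
  show "((\<lambda>x. Fhat P (fst x) (snd x) \<bullet> b) has_derivative (\<lambda>x. blinfun_apply (Fhat_deriv P z) x \<bullet> b)) (at z)"
    by (simp add: b inner_axis Fhat_nth Fhat_deriv_apply)
qed

lemma continuous_on_Fhat_deriv:
  assumes "central_nlp P"
  shows "continuous_on S (Fhat_deriv P)"
proof (rule continuous_on_blinfun_componentwise)
  fix w :: "(real ^ 'b) \<times> (real ^ 'b)"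
  have "continuous_on S (\<lambda>z. pd l (own_part P k) (mix P i (fst z) (snd z)))" for l k i
    using Ck_continuous_on[OF Ck_pd[OF Ck_own_part[OF assms]]] continuous_on_mix
    by (rule continuous_on_compose2) simp
  moreover have "continuous_on S (\<lambda>z. pd l (coupling_part P k) (snd z))" for l k
    using Ck_continuous_on[OF Ck_pd[OF Ck_coupling_part[OF assms]]] continuous_on_snd[OF continuous_on_id]
    by (rule continuous_on_compose2) simp
  ultimately show "continuous_on S (\<lambda>z. blinfun_apply (Fhat_deriv P z) w)"
    unfolding Fhat_deriv_apply by (intro continuous_intros continuous_on_vec_lambda)
qed

section \<open>Derivatives that vanish for neighbor-affine couplings\<close>

lemma affine_split_pd:
  assumes "affine_split P i F F0 F1" "agent P k \<noteq> i"
  shows "pd k F = (\<lambda>p. \<Sum>j\<in>nbrs P i. pd k (F1 j) p)"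
proof
  fix p
  have C: "Ck (Suc 2) F0" "\<And>j. j \<in> nbrs P i \<Longrightarrow> Ck (Suc 2) (F1 j)"
    using assms(1) unfolding affine_split_def by auto
  have F: "F = (\<lambda>p. F0 p + (\<Sum>j\<in>nbrs P i. F1 j p))"
    using assms(1) unfolding affine_split_def by blast
  have "k \<notin> prims P i" using assms(2) by (simp add: prims_def)
  then have F0: "pd k F0 = (\<lambda>p. 0)"
    using assms(1) depends_only_on_imp_pd_eq_0 C(1) unfolding affine_split_def by blast
  have "Ck (Suc 2) (\<lambda>p. \<Sum>j\<in>nbrs P i. F1 j p)"
    by (intro Ck_sum C(2))
  then have "pd k F p = pd k F0 p + pd k (\<lambda>p. \<Sum>j\<in>nbrs P i. F1 j p) p"
    unfolding F using C(1) by (intro pd_add Ck_Suc_differentiable)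
  also have "\<dots> = (\<Sum>j\<in>nbrs P i. pd k (F1 j) p)"
    using pd_sum[where F = F1 and A = "nbrs P i" and k = k, OF C(2)] F0 by simp
  finally show "pd k F p = (\<Sum>j\<in>nbrs P i. pd k (F1 j) p)" .
qed

text \<open>Only coupling terms can involve a coordinate of another agent: if \<open>k\<close>
  belongs to \<open>x_j\<close> the gradient hypothesis applies, and otherwise \<open>F1 j\<close>
  is independent of \<open>k\<close>.\<close>

lemma affine_split_pd_zero:
  assumes split: "affine_split P i F F0 F1" and k: "agent P k \<noteq> i"
    and grad: "\<And>j. j \<in> nbrs P i \<Longrightarrow> grad_block_zero (prims P j) (F1 j) ps"
  shows "pd k F ps = 0"
proof -
  have "pd k (F1 j) ps = 0" if j: "j \<in> nbrs P i" for j
  proof (cases "k \<in> prims P j")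
    case True
    then show ?thesis using grad[OF j] by (simp add: grad_block_zero_def)
  next
    case False
    with k have "k \<notin> prims P i \<union> prims P j" by (simp add: prims_def)
    then show ?thesis
      using split j depends_only_on_imp_pd_eq_0[of "prims P i \<union> prims P j" "F1 j" 2 k]
      by (simp add: affine_split_def)
  qed
  then show ?thesis by (simp add: affine_split_pd[OF split k])
qed

lemma affine_split_pd_pd_zero:
  assumes split: "affine_split P i F F0 F1" and k: "agent P k \<noteq> i"
    and hess: "\<And>j. j \<in> nbrs P i \<Longrightarrow> hess_block_zero (prims P i) (prims P j) (F1 j) ps \<and>
        hess_block_zero (prims P j) (prims P j) (F1 j) ps"
  shows "pd l (pd k F) ps = 0"
proof -
  have C: "Ck (Suc (Suc (Suc 0))) (F1 j)" and D: "depends_only_on (prims P i \<union> prims P j) (F1 j)"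
    if "j \<in> nbrs P i" for j
    using split that unfolding affine_split_def numeral_3_eq_3 by blast+
  have zero: "pd l (pd k (F1 j)) ps = 0" if j: "j \<in> nbrs P i" for j
  proof -
    \<comment> \<open>Either \<open>k\<close> or \<open>l\<close> is invisible to
      \<open>F1 j\<close>, or the pair falls into one of the two assumed zero Hessian blocks. When
      \<open>l\<close> is the invisible one, the derivatives are swapped first.\<close>
    consider "k \<notin> prims P j" | "k \<in> prims P j" "l \<in> prims P i \<union> prims P j" | "l \<notin> prims P i \<union> prims P j"
      by blast
    then show ?thesis
    proof cases
      case 1
      with k have "k \<notin> prims P i \<union> prims P j" by (simp add: prims_def)
      then show ?thesis using depends_only_on_imp_pd_eq_0[OF D[OF j] C[OF j]] by simp
    next
      case 2
      then show ?thesis using hess[OF j] by (auto simp: hess_block_zero_def)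
    next
      case 3
      then show ?thesis
        using depends_only_on_imp_pd_eq_0[OF D[OF j] C[OF j]] pd_commute[OF C[OF j], of l k] by simp
    qed
  qed
  have "pd l (pd k F) ps = (\<Sum>j\<in>nbrs P i. pd l (pd k (F1 j)) ps)"
    unfolding affine_split_pd[OF split k] by (rule fun_cong[OF pd_sum[OF Ck_pd[OF C]]])
  with zero show ?thesis by simp
qed

text \<open>This collects what the structural hypotheses yield at \<open>ps\<close> for a coordinate
  \<open>k\<close> outside agent \<open>i\<close>. First derivatives are restricted for constraints
  only: the residual contains gradients of the costs, so its derivative sees their second
  derivatives.\<close>

definition neighbor_decoupled :: "('v::finite, 'k::finite) nlp \<Rightarrow> real ^ 'k \<Rightarrow> bool" where
  "neighbor_decoupled P ps \<longleftrightarrow> (\<forall>i k. agent P k \<noteq> i \<longrightarrow>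
     (\<forall>l. pd l (pd k (cost P i)) ps = 0) \<and>
     (\<forall>e\<in>eqs P i. pd k (eqcon P e) ps = 0 \<and> (\<forall>l. pd l (pd k (eqcon P e)) ps = 0)) \<and>
     (\<forall>e\<in>ineqs P i. pd k (ineqcon P e) ps = 0 \<and> (\<forall>l. pd l (pd k (ineqcon P e)) ps = 0)))"

lemma pd_lagr_other_zero:
  assumes nlp: "central_nlp P" and dec: "neighbor_decoupled P ps"
    and "kind P k = Primal" "agent P k \<noteq> i"
  shows "pd l (pd k (lagr P i)) ps = 0"
  using dec assms(4) unfolding pd_pd_lagr_Primal[OF nlp assms(3)] neighbor_decoupled_def
  by (auto intro!: sum.neutral)

text \<open>One of the two ways in which the parameter \<open>q\<close> enters the residual: the
  neighbours' Lagrangian gradients have zero total derivative at \<open>ps\<close>, also with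
  respect to multipliers, since the foreign constraint gradients vanish.\<close>

lemma pd_coupling_part_zero:
  assumes nlp: "central_nlp P" and dec: "neighbor_decoupled P ps"
  shows "pd l (coupling_part P k) ps = 0"
proof (cases "kind P k = Primal")
  case True
  have "agent P k \<noteq> j" if "j \<in> nbrs P (agent P k)" for j
    using that by (auto simp: nbrs_def)
  then show ?thesis
    using pd_lagr_other_zero[OF nlp dec True]
      pd_sum[where F = "\<lambda>j. pd k (lagr P j)" and k = l, OF Ck_pd[OF Ck_lagr[OF nlp]]]
    by (simp add: coupling_part_def True)
next
  case False
  then have "coupling_part P k = (\<lambda>q. 0)" by (auto simp: coupling_part_def split: coord_kind.split)
  then show ?thesis by simp
qed

text \<open>The other way in which \<open>q\<close> enters: through the neighbours' coordinates of
  the mixed point.\<close>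

lemma pd_own_part_zero:
  assumes nlp: "central_nlp P" and dec: "neighbor_decoupled P ps" and l: "agent P l \<noteq> agent P k"
  shows "pd l (own_part P k) ps = 0"
proof (cases P k rule: kind_cases)
  case 1
  let ?i = "agent P k"
  \<comment> \<open>In \<open>neighbor_decoupled\<close> the foreign coordinate is the inner
    derivative, whereas here it is the outer one, hence the swap.\<close>
  note c = pd_commute[OF nlp_Ck3(1)[OF nlp], of l k ?i] 
    pd_commute[OF nlp_Ck3(2)[OF nlp, of _ ?i], of _ l k]
    pd_commute[OF nlp_Ck3(3)[OF nlp, of _ ?i], of _ l k]
  have "l \<noteq> e" if "e \<in> eqs P ?i \<or> e \<in> ineqs P ?i" for e
    using l that by (auto simp: eqs_def ineqs_def)
  then show ?thesis
    using dec l by (auto simp: own_part_def 1 pd_pd_lagr_Primal[OF nlp 1(1)] c neighbor_decoupled_def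
      intro!: sum.neutral)
next
  case 2
  with dec l show ?thesis by (simp add: own_part_def neighbor_decoupled_def)
next
  case 3
  with dec l show ?thesis
    by (auto simp: own_part_def pd_coord_mult[OF nlp_Ck3(3)[OF nlp 3(2)]] neighbor_decoupled_def)
qed

lemma sum_over_agent:
  fixes P :: "('v::finite, 'k::finite) nlp" and F :: "'k \<Rightarrow> 'b::comm_monoid_add"
  shows "sum F {l. agent P l = i} = sum F (prims P i) + sum F (eqs P i) + sum F (ineqs P i)"
proof -
  have "l \<in> prims P i \<union> eqs P i \<union> ineqs P i" if "agent P l = i" for l
    using that by (cases P l rule: kind_cases) auto
  then have "{l. agent P l = i} = prims P i \<union> eqs P i \<union> ineqs P i"
    by (auto simp: prims_def eqs_def ineqs_def)
  moreover have "prims P i \<inter> eqs P i = {}" "(prims P i \<union> eqs P i) \<inter> ineqs P i = {}"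
    by (auto simp: prims_def eqs_def ineqs_def)
  ultimately show ?thesis by (simp add: sum.union_disjoint)
qed

section \<open>Nonsingularity of the local KKT systems\<close>

text \<open>Multiply the stationarity rows by \<open>s\<close> and sum. Exchanging the sums turns
  each constraint term into a Jacobian row applied to \<open>s\<close>, which is zero; only the
  quadratic form is left, and it would be positive if \<open>s\<close> did not vanish on
  \<open>X\<close>.\<close>

lemma second_order_cond_imp_zero:
  assumes SOC: "second_order_cond P X G A L p" and C: "Ck (Suc (Suc n)) L"
    and G: "\<And>e. e \<in> G \<Longrightarrow> (\<Sum>k\<in>X. pd k (eqcon P e) p * s $ k) = 0"
    and A: "\<And>e. e \<in> A \<Longrightarrow> (\<Sum>k\<in>X. pd k (ineqcon P e) p * s $ k) = 0"
    and stat: "\<And>k. k \<in> X \<Longrightarrow> (\<Sum>l\<in>X. pd l (pd k L) p * s $ l)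
      + (\<Sum>e\<in>G. pd k (eqcon P e) p * s $ e) + (\<Sum>e\<in>A. pd k (ineqcon P e) p * s $ e) = 0"
    and "k \<in> X"
  shows "s $ k = 0"
proof (rule ccontr)
  assume "s $ k \<noteq> 0"
  then have pos: "(\<Sum>k\<in>X. \<Sum>l\<in>X. s $ k * pd k (pd l L) p * s $ l) > 0"
    using SOC G A \<open>k \<in> X\<close> unfolding second_order_cond_def by blast
  have zero: "(\<Sum>k\<in>X. s $ k * (\<Sum>e\<in>E. pd k (H e) p * s $ e)) = 0"
    if "\<And>e. e \<in> E \<Longrightarrow> (\<Sum>k\<in>X. pd k (H e) p * s $ k) = 0" for E :: "'b set" and H
  proof -
    have "(\<Sum>k\<in>X. s $ k * (\<Sum>e\<in>E. pd k (H e) p * s $ e)) = (\<Sum>k\<in>X. \<Sum>e\<in>E. s $ e * (pd k (H e) p * s $ k))"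
      by (simp add: sum_distrib_left mult_ac)
    also have "\<dots> = (\<Sum>e\<in>E. s $ e * (\<Sum>k\<in>X. pd k (H e) p * s $ k))"
      by (subst sum.swap) (simp add: sum_distrib_left)
    finally show ?thesis using that by simp
  qed
  have "0 = (\<Sum>k\<in>X. s $ k * ((\<Sum>l\<in>X. pd l (pd k L) p * s $ l)
      + (\<Sum>e\<in>G. pd k (eqcon P e) p * s $ e) + (\<Sum>e\<in>A. pd k (ineqcon P e) p * s $ e)))"
    using stat by simp
  also have "\<dots> = (\<Sum>k\<in>X. s $ k * (\<Sum>l\<in>X. pd l (pd k L) p * s $ l))"
    using zero[OF G] zero[OF A] by (simp add: distrib_left sum.distrib)
  also have "\<dots> = (\<Sum>k\<in>X. \<Sum>l\<in>X. s $ k * pd k (pd l L) p * s $ l)"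
    unfolding pd_commute[OF C] by (simp add: sum_distrib_left mult_ac)
  finally show False using pos by simp
qed

text \<open>The usual KKT matrix argument, agent by agent: constraint rows make \<open>s\<close>
  tangent, the second-order condition removes its primal part, and independence of the gradients
  removes its multiplier part. Strict complementarity decides what each inequality row says.\<close>

lemma own_part_derivative_injective:
  assumes nlp: "central_nlp P" and KKT: "central_KKT P ps"
    and central: "central_regular P ps" and agents: "local_regular P ps"
    and s: "\<And>k. (\<Sum>l\<in>{l. agent P l = agent P k}. pd l (own_part P k) ps * s $ l) = 0"
  shows "s = 0"
proof -
  have "\<forall>k. agent P k = i \<longrightarrow> s $ k = 0" for i
  proof -
    let ?X = "prims P i" and ?G = "eqs P i" and ?I = "ineqs P i" and ?A = "active P i ps"
    have sub: "?A \<subseteq> ?I" by (auto simp: active_def)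
    have notX: "e \<notin> nbhd_prims P i" if "e \<in> ?G \<or> e \<in> ?I" for e
      using that by (auto simp: nbhd_prims_def prims_def eqs_def ineqs_def)
    have G: "(\<Sum>k\<in>?X. pd k (eqcon P e) ps * s $ k) = 0" if e: "e \<in> ?G" for e
    proof -
      have "agent P e = i" "kind P e = Eq_Mult" using e by (auto simp: eqs_def)
      with s[of e] show ?thesis
        using nlp_pd_eq_0(2)[OF nlp notX e] by (simp add: sum_over_agent own_part_def)
    qed
    have I: "s $ e * ineqcon P e ps + ps $ e * (\<Sum>k\<in>?X. pd k (ineqcon P e) ps * s $ k) = 0"
      if e: "e \<in> ?I" for e
    proof -
      have *: "agent P e = i" "kind P e = Ineq_Mult" using e by (auto simp: ineqs_def)
      have "e \<notin> ?X" "e \<notin> ?G" using e by (auto simp: prims_def eqs_def ineqs_def)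
      then have "l \<noteq> e" if "l \<in> ?X \<or> l \<in> ?G" for l using that by blast
      with s[of e] show ?thesis
        using nlp_pd_eq_0(3)[OF nlp notX e] e
        by (simp add: * sum_over_agent own_part_def pd_coord_mult[OF nlp_Ck3(3)[OF nlp e]] sum.delta
            if_distrib[of "\<lambda>x. _ * x"] sum_distrib_left mult_ac cong: sum.cong if_cong)
    qed
    \<comment> \<open>For an active constraint the row loses its first term, and the positive
      multiplier can be cancelled.\<close>
    have A: "(\<Sum>k\<in>?X. pd k (ineqcon P e) ps * s $ k) = 0" if e: "e \<in> ?A" for e
    proof -
      have "ps $ e > 0" using central e unfolding central_regular_def Let_def by blast
      with I[of e] e show ?thesis by (simp add: active_def)
    qed
    \<comment> \<open>For an inactive constraint complementarity gives a zero multiplier, so the row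
      forces the multiplier direction itself to vanish.\<close>
    have inactive: "s $ e = 0" if e: "e \<in> ?I - ?A" for e
    proof -
      have "ineqcon P e ps \<noteq> 0" using e by (simp add: active_def)
      moreover from this have "ps $ e = 0" using KKT e unfolding central_KKT_def by auto
      ultimately show ?thesis using I[of e] e by simp
    qed
    have stat: "(\<Sum>l\<in>?X. pd l (pd k (lagr P i)) ps * s $ l)
      + (\<Sum>e\<in>?G. pd k (eqcon P e) ps * s $ e) + (\<Sum>e\<in>?A. pd k (ineqcon P e) ps * s $ e) = 0"
      if k: "k \<in> ?X" for k
    proof -
      have *: "agent P k = i" "kind P k = Primal" using k by (auto simp: prims_def)
      \<comment> \<open>Costs and constraints do not depend on multipliers, so in a multiplier
        column of a stationarity row only the matching constraint gradient survives.\<close>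
      have H: "pd l (pd k (cost P i)) ps = 0" "e \<in> ?G \<Longrightarrow> pd l (pd k (eqcon P e)) ps = 0"
        "e \<in> ?I \<Longrightarrow> pd l (pd k (ineqcon P e)) ps = 0" if "l \<in> ?G \<or> l \<in> ?I" for l e
        using nlp_pd_eq_0[OF nlp notX[OF that]]
        by (simp_all add: pd_commute[OF nlp_Ck3(1)[OF nlp], of l k] pd_commute[OF nlp_Ck3(2)[OF nlp], of _ _ l k]
            pd_commute[OF nlp_Ck3(3)[OF nlp], of _ _ l k])
      have disj: "?G \<inter> ?I = {}" by (auto simp: eqs_def ineqs_def)
      have "pd l (pd k (lagr P i)) ps = pd k (eqcon P l) ps" if "l \<in> ?G" for l
        unfolding pd_pd_lagr_Primal[OF nlp *(2)] using that H disj
        by (auto simp: sum.delta cong: sum.cong if_cong intro!: sum.neutral)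
      moreover have "pd l (pd k (lagr P i)) ps = pd k (ineqcon P l) ps" if "l \<in> ?I" for l
        unfolding pd_pd_lagr_Primal[OF nlp *(2)] using that H disj
        by (auto simp: sum.delta cong: sum.cong if_cong intro!: sum.neutral)
      moreover have "(\<Sum>e\<in>?I. pd k (ineqcon P e) ps * s $ e) = (\<Sum>e\<in>?A. pd k (ineqcon P e) ps * s $ e)"
        by (rule sum.mono_neutral_right) (use sub inactive in auto)
      ultimately show ?thesis
        using s[of k] by (simp add: * sum_over_agent own_part_def cong: sum.cong)
    qed
    have X: "s $ k = 0" if "k \<in> ?X" for k
      using agents G A stat that unfolding local_regular_def
      by (intro second_order_cond_imp_zero[OF _ Ck_lagr[OF nlp]]) blast+
    \<comment> \<open>With the primal part gone, stationarity is a vanishing linear combination of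
      the active constraint gradients.\<close>
    have "\<forall>k\<in>?X. (\<Sum>e\<in>?G. s $ e * pd k (eqcon P e) ps) + (\<Sum>e\<in>?A. s $ e * pd k (ineqcon P e) ps) = 0"
      using stat X by (simp add: mult.commute)
    then have "\<forall>e\<in>?G. s $ e = 0" "\<forall>e\<in>?A. s $ e = 0"
      using agents unfolding local_regular_def constraint_gradients_independent_def by blast+
    with inactive have "\<forall>e\<in>?I. s $ e = 0" by blast
    with X \<open>\<forall>e\<in>?G. s $ e = 0\<close> show ?thesis
      using kind_cases[of P] by blast
  qed
  then have "s $ k = 0" for k by blast
  then show ?thesis by (simp add: vec_eq_iff)
qed

section \<open>Zeros of the residual and existence of the solution map\<close>

lemma Fhat_deriv_own:
  "blinfun_apply (Fhat_deriv P (ps, ps)) (s, 0) $ k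
    = (\<Sum>l\<in>{l. agent P l = agent P k}. pd l (own_part P k) ps * s $ l)"
  by (simp add: Fhat_deriv_apply mix_def if_distrib[of "\<lambda>x. _ * x"] sum.If_cases cong: if_cong)

text \<open>At \<open>p = q\<close> the primal row adds the gradients of agent \<open>i\<close> and
  its neighbours. No other agent's Lagrangian contains \<open>x_i\<close>, so this is the gradient
  of the full Lagrangian.\<close>

lemma Fhat_KKT_point:
  assumes nlp: "central_nlp P" and KKT: "central_KKT P ps"
  shows "Fhat P ps ps = 0"
proof -
  have "Fhat P ps ps $ k = 0" for k
  proof (cases P k rule: kind_cases)
    case 1
    let ?i = "agent P k"
    have "pd k (lagr P j) = (\<lambda>p. 0)" if "j \<notin> insert ?i (nbrs P ?i)" for j
    proof -
      \<comment> \<open>The sum runs over neighbours of the owner of \<open>k\<close>, whereas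
        dependence of agent \<open>j\<close> on \<open>k\<close> is governed by the neighbours of
        \<open>j\<close>; symmetry reconciles the two.\<close>
      have "sym (edges P)" using nlp by (simp add: central_nlp_def)
      then have "k \<notin> nbhd_prims P j"
        using that by (auto simp: nbhd_prims_def prims_def nbrs_def dest: symD)
      then show ?thesis
        using nlp_pd_eq_0[OF nlp] by (simp add: pd_lagr_Primal[OF nlp 1(1)])
    qed
    then have "(\<Sum>j\<in>insert ?i (nbrs P ?i). pd k (lagr P j) ps) = (\<Sum>j\<in>UNIV. pd k (lagr P j) ps)"
      by (intro sum.mono_neutral_left) auto
    also have "\<dots> = pd k (lagrangian P) ps"
      unfolding lagrangian_def by (simp add: pd_sum[OF Ck_lagr[OF nlp]])
    also have "\<dots> = 0" using KKT 1(2) unfolding central_KKT_def by blast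
    finally show ?thesis
      using 1 by (simp add: Fhat_nth own_part_def coupling_part_def nbrs_def)
  qed (use KKT in \<open>auto simp: Fhat_nth own_part_def coupling_part_def central_KKT_def\<close>)
  then show ?thesis by (simp add: vec_eq_iff)
qed

text \<open>In this region a zero of \<open>Fhat\<close> satisfies the inequalities of \<^const>\<open>local_KKT\<close>: complementarity
  forces \<open>h\<^sub>k = 0\<close> for the constraints active at \<open>ps\<close> and \<open>\<mu>\<^sub>k = 0\<close> for the others.\<close>

definition strict_region :: "('v::finite, 'k::finite) nlp \<Rightarrow> real ^ 'k \<Rightarrow> ((real ^ 'k) \<times> (real ^ 'k)) set" where
  "strict_region P ps = (\<Inter>i. \<Inter>k\<in>ineqs P i.
     if ineqcon P k ps = 0 then {z. 0 < fst z $ k} else {z. ineqcon P k (mix P i (fst z) (snd z)) < 0})"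

lemma open_strict_region:
  assumes nlp: "central_nlp P"
  shows "open (strict_region P ps)"
proof -
  have "open {z. ineqcon P k (mix P i (fst z) (snd z)) < 0}" if "k \<in> ineqs P i" for k i
    by (intro open_Collect_less continuous_on_const
        continuous_on_compose2[OF Ck_continuous_on[OF nlp_Ck(3)[OF nlp that]] continuous_on_mix]) simp
  moreover have "open {z :: (real ^ 'b) \<times> (real ^ 'b). 0 < fst z $ k}" for k :: 'b
    by (intro open_Collect_less continuous_intros)
  ultimately show ?thesis
    unfolding strict_region_def by (intro open_INT finite ballI) auto
qed

text \<open>Strict complementarity handles the active constraints, feasibility the inactive
  ones.\<close>

lemma KKT_point_in_strict_region:
  assumes "central_KKT P ps" "central_regular P ps"
  shows "(ps, ps) \<in> strict_region P ps"
proof -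
  have "ps $ k > 0" if "k \<in> ineqs P i" "ineqcon P k ps = 0" for i k
    using assms(2) that unfolding central_regular_def Let_def active_def by blast
  moreover have "ineqcon P k ps \<le> 0" if "k \<in> ineqs P i" for i k
    using assms(1) that unfolding central_KKT_def by blast
  ultimately show ?thesis
    unfolding strict_region_def by (force simp: order_less_le)
qed

lemma local_KKT_iff:
  assumes "(p, q) \<in> strict_region P ps"
  shows "local_KKT P p q \<longleftrightarrow> Fhat P p q = 0"
proof
  assume F: "Fhat P p q = 0"
  have "ineqcon P k (mix P i p q) \<le> 0 \<and> p $ k \<ge> 0" if k: "k \<in> ineqs P i" for i k
  proof -
    have *: "agent P k = i" "kind P k = Ineq_Mult" using k by (auto simp: ineqs_def)
    have "Fhat P p q $ k = p $ k * ineqcon P k (mix P i p q)"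
      by (simp add: Fhat_def *)
    then have "p $ k * ineqcon P k (mix P i p q) = 0" by (simp add: F)
    moreover have "p $ k > 0 \<or> ineqcon P k (mix P i p q) < 0"
    proof -
      have "(p, q) \<in> (if ineqcon P k ps = 0 then {z. 0 < fst z $ k}
          else {z. ineqcon P k (mix P i (fst z) (snd z)) < 0})"
        using assms k unfolding strict_region_def by blast
      then show ?thesis by (simp split: if_splits)
    qed
    ultimately show ?thesis by auto
  qed
  with F show "local_KKT P p q" by (simp add: local_KKT_def)
qed (simp add: local_KKT_def)

text \<open>The implicit function lemma is run inside \<open>strict_region\<close>. On the resulting
  box zeros of \<open>Fhat\<close> and local KKT points coincide, so uniqueness carries over from
  the equations to the full system.\<close>

lemma solution_map_exists:
  assumes nlp: "central_nlp P" and KKT: "central_KKT P ps"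
    and central: "central_regular P ps" and agents: "local_regular P ps"
  shows "\<exists>\<Phi>. solution_map P ps \<Phi>"
proof -
  have inj: "s = 0" if "blinfun_apply (Fhat_deriv P (ps, ps)) (s, 0) = 0" for s
    by (rule own_part_derivative_injective[OF assms]) (simp add: Fhat_deriv_own[symmetric] that)
  have F0: "Fhat P (fst (ps, ps)) (snd (ps, ps)) = 0"
    using Fhat_KKT_point[OF nlp KKT] by simp
  obtain \<Phi> \<Phi>' \<delta> \<epsilon> where *: "\<delta> > 0" "\<epsilon> > 0" "ball ps \<epsilon> \<times> ball ps \<delta> \<subseteq> strict_region P ps" "\<Phi> ps = ps"
    "\<And>q. q \<in> ball ps \<delta> \<Longrightarrow> (\<Phi> has_derivative blinfun_apply (\<Phi>' q)) (at q)"
    "continuous_on (ball ps \<delta>) \<Phi>'"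
    "\<And>q. q \<in> ball ps \<delta> \<Longrightarrow> \<Phi> q \<in> ball ps \<epsilon> \<and> Fhat P (fst (\<Phi> q, q)) (snd (\<Phi> q, q)) = 0"
    "\<And>p q. p \<in> ball ps \<epsilon> \<Longrightarrow> q \<in> ball ps \<delta> \<Longrightarrow> Fhat P (fst (p, q)) (snd (p, q)) = 0 \<Longrightarrow> p = \<Phi> q"
    by (rule implicit_function_C1[where F = "\<lambda>z. Fhat P (fst z) (snd z)" and F' = "Fhat_deriv P",
          OF open_strict_region[OF nlp] KKT_point_in_strict_region[OF KKT central]
            has_derivative_Fhat[OF nlp] continuous_on_Fhat_deriv[OF nlp] F0 inj])
      (assumption, rule that, assumption+)
  have "C1_map_on (ball ps \<delta>) \<Phi>"
    unfolding C1_map_on_def using *(5,6) by blast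
  moreover have "\<forall>q\<in>ball ps \<delta>. \<Phi> q \<in> ball ps \<epsilon> \<and> local_KKT P (\<Phi> q) q \<and>
           (\<forall>p\<in>ball ps \<epsilon>. local_KKT P p q \<longrightarrow> p = \<Phi> q)"
  proof (intro ballI conjI impI)
    fix q assume q: "q \<in> ball ps \<delta>"
    show \<Phi>: "\<Phi> q \<in> ball ps \<epsilon>" using *(7)[OF q] by blast
    have KKT_iff: "local_KKT P p q \<longleftrightarrow> Fhat P p q = 0" if "p \<in> ball ps \<epsilon>" for p
      using that q *(3) by (intro local_KKT_iff) blast
    show "local_KKT P (\<Phi> q) q" using KKT_iff[OF \<Phi>] *(7)[OF q] by simp
    show "p = \<Phi> q" if "p \<in> ball ps \<epsilon>" "local_KKT P p q" for p
      using *(8)[OF that(1) q] KKT_iff[OF that(1)] that(2) by simp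
  qed
  ultimately show ?thesis
    unfolding solution_map_def using *(1,2,4) by blast
qed

section \<open>Quadratic convergence\<close>

text \<open>On a small enough ball the quadratic estimate also halves the error. This keeps the
  iterates in the ball, where the estimate remains available, and yields convergence.\<close>

lemma quadratic_step_imp_convergent:
  fixes \<Phi> :: "real ^ 'k::finite \<Rightarrow> real ^ 'k"
  assumes "d > 0" and step: "\<And>q. q \<in> ball ps d \<Longrightarrow> norm (\<Phi> q - ps) \<le> C * (norm (q - ps))\<^sup>2"
  shows "quadratically_convergent \<Phi> ps"
proof -
  \<comment> \<open>No sign of \<open>C\<close> is assumed; the maximum with 1 makes
    \<open>1 / (2 * K)\<close> a positive radius with \<open>K * r \<le> 1 / 2\<close>.\<close>
  define K where "K = max C 1"
  define r where "r = min d (1 / (2 * K))"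
  have K: "K > 0" "C \<le> K" by (auto simp: K_def)
  have r: "r > 0" "r \<le> d" "K * r \<le> 1 / 2" using \<open>d > 0\<close> K by (auto simp: r_def min_def field_simps)
  have quad: "norm (\<Phi> q - ps) \<le> K * (norm (q - ps))\<^sup>2" if "q \<in> ball ps r" for q
    using step[of q] that r(2) mult_right_mono[OF K(2), of "(norm (q - ps))\<^sup>2"] by auto
  have half: "norm (\<Phi> q - ps) \<le> norm (q - ps) / 2" if q: "q \<in> ball ps r" for q
  proof -
    have "K * norm (q - ps) \<le> K * r"
      using q K(1) by (intro mult_left_mono) (auto simp: dist_norm norm_minus_commute)
    with r(3) have "K * norm (q - ps) * norm (q - ps) \<le> 1 / 2 * norm (q - ps)"
      by (intro mult_right_mono) auto
    with quad[OF q] show ?thesis by (simp add: power2_eq_square mult.assoc)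
  qed
  have "p \<longlonglongrightarrow> ps \<and> (\<forall>q\<ge>1. norm (p q - ps) \<le> K * (norm (p (q - 1) - ps))\<^sup>2)"
    if p0: "p 0 \<in> ball ps r" and "generated_by \<Phi> p" for p
  proof (intro conjI allI impI)
    have rec: "p (Suc n) = \<Phi> (p n)" for n using \<open>generated_by \<Phi> p\<close> by (auto simp: generated_by_def)
    have *: "p n \<in> ball ps r \<and> norm (p n - ps) \<le> (1/2) ^ n * norm (p 0 - ps)" for n
    proof (induction n)
      case (Suc n)
      then have "norm (p (Suc n) - ps) \<le> norm (p n - ps) / 2" using half rec by simp
      moreover have "norm (p n - ps) < r" using Suc by (simp add: dist_norm norm_minus_commute)
      ultimately have "norm (p (Suc n) - ps) < r" by (smt (verit) norm_ge_zero field_sum_of_halves)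
      with Suc \<open>norm (p (Suc n) - ps) \<le> norm (p n - ps) / 2\<close> show ?case
        by (auto simp: dist_norm norm_minus_commute)
    qed (use p0 in simp)
    have "(\<lambda>n. (1/2) ^ n * norm (p 0 - ps)) \<longlonglongrightarrow> 0"
      by (intro tendsto_mult_left_zero LIMSEQ_power_zero) simp
    then have "(\<lambda>n. p n - ps) \<longlonglongrightarrow> 0"
      by (rule Lim_null_comparison[rotated]) (use * in simp)
    then show "p \<longlonglongrightarrow> ps" by (simp add: LIM_zero_iff)
    show "norm (p q - ps) \<le> K * (norm (p (q - 1) - ps))\<^sup>2" if "q \<ge> 1" for q
      using quad[of "p (q - 1)"] * rec[of "q - 1"] that by simp
  qed
  with \<open>r > 0\<close> show ?thesis
    unfolding quadratically_convergent_def by blast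
qed

text \<open>About \<open>\<Phi>\<close> the argument takes only the fixed point, differentiability
  at \<open>ps\<close> and the equation \<open>Fhat P (\<Phi> q) q = 0\<close>, so it covers every
  solution map.\<close>

lemma solution_map_quadratic_step:
  assumes nlp: "central_nlp P" and KKT: "central_KKT P ps"
    and central: "central_regular P ps" and agents: "local_regular P ps"
    and dec: "neighbor_decoupled P ps" and sol: "solution_map P ps \<Phi>"
  obtains C d where "d > 0" "\<And>q. q \<in> ball ps d \<Longrightarrow> norm (\<Phi> q - ps) \<le> C * (norm (q - ps))\<^sup>2"
proof -
  define A where "A s = blinfun_apply (Fhat_deriv P (ps, ps)) (s, 0)" for s
  have lin: "bounded_linear A"
    unfolding A_def by (intro bounded_linear_intros)
  have "inj A"
    by (rule linear_injective_0[THEN iffD2, OF bounded_linear.linear[OF lin]], intro allI impI,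
        rule own_part_derivative_injective[OF nlp KKT central agents])
      (simp add: A_def Fhat_deriv_own[symmetric])
  \<comment> \<open>An injective linear map in finite dimension is bounded below; \<open>b\<close>
    turns an estimate of \<open>A (\<Phi> q - ps)\<close> into one of
    \<open>\<Phi> q - ps\<close>.\<close>
  then obtain b where b: "b > 0" "\<And>s. b * norm s \<le> norm (A s)"
    using linear_inj_bounded_below_pos[OF bounded_linear.linear[OF lin]] by metis
  obtain \<delta> where \<delta>: "\<delta> > 0" "C1_map_on (ball ps \<delta>) \<Phi>" "\<And>q. q \<in> ball ps \<delta> \<Longrightarrow> local_KKT P (\<Phi> q) q"
    and fix_ps: "\<Phi> ps = ps"
    using sol unfolding solution_map_def by blast
  then obtain D where "(\<Phi> has_derivative D) (at ps)"
    unfolding C1_map_on_def by (meson centre_in_ball)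
  then obtain K d0 where K: "K > 0" "d0 > 0" "\<And>q. q \<in> ball ps d0 \<Longrightarrow> norm (\<Phi> q - ps) \<le> K * norm (q - ps)"
    using has_derivative_imp_locally_Lipschitz fix_ps by metis
  have "\<forall>k. \<exists>C d. d > 0 \<and> C > 0 \<and> (\<forall>z\<in>ball ps d.
      \<bar>own_part P k z - own_part P k ps - (\<Sum>l\<in>UNIV. pd l (own_part P k) ps * (z - ps) $ l)\<bar> \<le> C * (norm (z - ps))\<^sup>2)"
  proof
    fix k show "\<exists>C d. d > 0 \<and> C > 0 \<and> (\<forall>z\<in>ball ps d.
      \<bar>own_part P k z - own_part P k ps - (\<Sum>l\<in>UNIV. pd l (own_part P k) ps * (z - ps) $ l)\<bar> \<le> C * (norm (z - ps))\<^sup>2)"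
      by (rule Ck2_quadratic_remainder[OF Ck_own_part[OF nlp], of ps k]) blast
  qed
  then obtain Co eo where o: "\<And>k. Co k > 0" "\<And>k. eo k > 0" "\<And>k z. z \<in> ball ps (eo k) \<Longrightarrow>
      \<bar>own_part P k z - own_part P k ps - (\<Sum>l\<in>UNIV. pd l (own_part P k) ps * (z - ps) $ l)\<bar> \<le> Co k * (norm (z - ps))\<^sup>2"
    unfolding choice_iff by blast
  have "\<forall>k. \<exists>C d. d > 0 \<and> C > 0 \<and> (\<forall>z\<in>ball ps d.
      \<bar>coupling_part P k z - coupling_part P k ps\<bar> \<le> C * (norm (z - ps))\<^sup>2)"
  proof
    fix k show "\<exists>C d. d > 0 \<and> C > 0 \<and> (\<forall>z\<in>ball ps d.
      \<bar>coupling_part P k z - coupling_part P k ps\<bar> \<le> C * (norm (z - ps))\<^sup>2)"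
      by (rule Ck2_quadratic_remainder[OF Ck_coupling_part[OF nlp], of ps k])
        (unfold pd_coupling_part_zero[OF nlp dec] mult_zero_left sum.neutral_const diff_zero, blast)
  qed
  then obtain Cc ec where c: "\<And>k. Cc k > 0" "\<And>k. ec k > 0" "\<And>k z. z \<in> ball ps (ec k) \<Longrightarrow>
      \<bar>coupling_part P k z - coupling_part P k ps\<bar> \<le> Cc k * (norm (z - ps))\<^sup>2"
    unfolding choice_iff by blast
  define e where "e = Min (range eo \<union> range ec)"
  have e: "e > 0" "\<And>k. e \<le> eo k" "\<And>k. e \<le> ec k"
    using o(2) c(2) by (auto simp: e_def)
  \<comment> \<open>The mixed point lies within \<open>(K + 1) * norm (q - ps)\<close> of
    \<open>ps\<close>: \<open>K\<close> for the entries from \<open>\<Phi> q\<close>, 1 for those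
    from \<open>q\<close>. Dividing by \<open>K + 1\<close> keeps it where the remainder estimates
    hold.\<close>
  define d where "d = min (min \<delta> d0) (e / (K + 1))"
  have d: "d > 0" "d \<le> \<delta>" "d \<le> d0" "d \<le> e / (K + 1)"
    using \<delta>(1) K(1,2) e(1) by (auto simp: d_def)
  from d(4) have Kd: "(K + 1) * d \<le> e" using K(1) by (simp add: field_simps)
  have "d \<le> (K + 1) * d" using K(1) d(1) by simp
  then have "d \<le> e" using Kd by linarith
  define C where "C = (\<Sum>k\<in>UNIV. Co k * (K + 1)\<^sup>2 + Cc k)"
  show ?thesis
  proof (rule that[of d "C / b", OF \<open>d > 0\<close>])
    fix q assume q: "q \<in> ball ps d"
    let ?n = "norm (q - ps)"
    have n: "?n < d" using q by (simp add: dist_norm norm_minus_commute)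
    have qb: "q \<in> ball ps \<delta>" "q \<in> ball ps d0" "\<And>k. q \<in> ball ps (ec k)"
      using q d(2,3) \<open>d \<le> e\<close> e(3) by (auto intro: less_le_trans order_trans)
    have "\<bar>A (\<Phi> q - ps) $ k\<bar> \<le> (Co k * (K + 1)\<^sup>2 + Cc k) * ?n\<^sup>2" for k
    proof -
      let ?z = "mix P (agent P k) (\<Phi> q) q"
      have z: "?z - ps = mix P (agent P k) (\<Phi> q - ps) (q - ps)"
        using mix_diff[of P "agent P k" "\<Phi> q" q ps ps] by simp
      have nz: "norm (?z - ps) \<le> (K + 1) * ?n"
        using norm_mix_le[of P "agent P k" "\<Phi> q - ps" "q - ps"] K(3)[OF qb(2)]
        by (simp add: z algebra_simps)
      also have "\<dots> < (K + 1) * d" using n K(1) by (intro mult_strict_left_mono) auto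
      finally have "?z \<in> ball ps (eo k)"
        using Kd e(2)[of k] by (simp add: dist_norm norm_minus_commute)
      note o(3)[OF this]
      \<comment> \<open>Neighbour entries of the mixed point have zero coefficient by decoupling;
        the remaining ones come from \<open>\<Phi> q\<close>.\<close>
      moreover have "(\<Sum>l\<in>UNIV. pd l (own_part P k) ps * (?z - ps) $ l) = A (\<Phi> q - ps) $ k"
      proof -
        have "(\<Sum>l\<in>UNIV. pd l (own_part P k) ps * (?z - ps) $ l)
          = (\<Sum>l\<in>{l. agent P l = agent P k}. pd l (own_part P k) ps * (?z - ps) $ l)"
          by (rule sum.mono_neutral_right) (auto simp: pd_own_part_zero[OF nlp dec])
        also have "\<dots> = (\<Sum>l\<in>{l. agent P l = agent P k}. pd l (own_part P k) ps * (\<Phi> q - ps) $ l)"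
          by (rule sum.cong) (auto simp: z mix_def)
        finally show ?thesis by (simp add: A_def Fhat_deriv_own)
      qed
      \<comment> \<open>Subtracting these equations makes the increment of the own part the negative
        of that of the coupling part, which is itself quadratic in \<open>q - ps\<close>.\<close>
      moreover have "own_part P k ?z + coupling_part P k q = 0" "own_part P k ps + coupling_part P k ps = 0"
        using \<delta>(3)[OF qb(1)] Fhat_nth[of P "\<Phi> q" q k] Fhat_nth[of P ps ps k] Fhat_KKT_point[OF nlp KKT]
        by (simp_all add: local_KKT_def)
      moreover note c(3)[OF qb(3)[of k]]
      moreover have "Co k * (norm (?z - ps))\<^sup>2 \<le> Co k * ((K + 1) * ?n)\<^sup>2"
        using nz o(1)[of k] by (intro mult_left_mono power_mono) auto
      ultimately have "\<bar>A (\<Phi> q - ps) $ k\<bar> \<le> Co k * ((K + 1) * ?n)\<^sup>2 + Cc k * ?n\<^sup>2"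
        by linarith
      then show ?thesis by (simp only: power_mult_distrib distrib_right[of _ "Cc k"] mult.assoc)
    qed
    then have "(\<Sum>k\<in>UNIV. \<bar>A (\<Phi> q - ps) $ k\<bar>) \<le> C * ?n\<^sup>2"
      unfolding C_def sum_distrib_right by (intro sum_mono)
    with norm_le_l1_cart[of "A (\<Phi> q - ps)"] b(2)[of "\<Phi> q - ps"] have "b * norm (\<Phi> q - ps) \<le> C * ?n\<^sup>2"
      by linarith
    then show "norm (\<Phi> q - ps) \<le> C / b * ?n\<^sup>2"
      using b(1) by (simp add: field_simps)
  qed
qed

lemma neighbor_affine_imp_decoupled:
  assumes form: "neighbor_affine P f0 f1 g0 g1 h0 h1"
    and f1: "\<And>i j. j \<in> nbrs P i \<Longrightarrow>
        hess_block_zero (prims P i) (prims P j) (f1 i j) ps \<and>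
        hess_block_zero (prims P j) (prims P j) (f1 i j) ps"
    and g1: "\<And>i j k. j \<in> nbrs P i \<Longrightarrow> k \<in> eqs P i \<Longrightarrow>
        grad_block_zero (prims P j) (g1 k j) ps \<and>
        hess_block_zero (prims P i) (prims P j) (g1 k j) ps \<and>
        hess_block_zero (prims P j) (prims P j) (g1 k j) ps"
    and h1: "\<And>i j k. j \<in> nbrs P i \<Longrightarrow> k \<in> ineqs P i \<Longrightarrow>
        grad_block_zero (prims P j) (h1 k j) ps \<and>
        hess_block_zero (prims P i) (prims P j) (h1 k j) ps \<and>
        hess_block_zero (prims P j) (prims P j) (h1 k j) ps"
  shows "neighbor_decoupled P ps"
  unfolding neighbor_decoupled_def
proof (intro allI impI conjI ballI)
  fix i k l e assume k: "agent P k \<noteq> i"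
  have split: "affine_split P i (cost P i) (f0 i) (f1 i)"
    "e \<in> eqs P i \<Longrightarrow> affine_split P i (eqcon P e) (g0 e) (g1 e)"
    "e \<in> ineqs P i \<Longrightarrow> affine_split P i (ineqcon P e) (h0 e) (h1 e)"
    using form unfolding neighbor_affine_def by blast+
  show "pd l (pd k (cost P i)) ps = 0"
    using affine_split_pd_pd_zero[OF split(1) k] f1 by blast
  show "pd k (eqcon P e) ps = 0" "pd l (pd k (eqcon P e)) ps = 0" if e: "e \<in> eqs P i"
    using affine_split_pd_zero[OF split(2)[OF e] k] affine_split_pd_pd_zero[OF split(2)[OF e] k] g1[OF _ e]
    by blast+
  show "pd k (ineqcon P e) ps = 0" "pd l (pd k (ineqcon P e)) ps = 0" if e: "e \<in> ineqs P i"
    using affine_split_pd_zero[OF split(3)[OF e] k] affine_split_pd_pd_zero[OF split(3)[OF e] k] h1[OF _ e]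
    by blast+
qed

text \<open>A solution map is prescribed only near \<open>ps\<close>, so the rate is claimed for all
  of them; the existence half ensures that this claim is not vacuous.\<close>

theorem corollary1:
  fixes P :: "('v::finite, 'k::finite) nlp"
    and ps :: "real ^ 'k"
    and f0 :: "'v \<Rightarrow> real ^ 'k \<Rightarrow> real" and f1 :: "'v \<Rightarrow> 'v \<Rightarrow> real ^ 'k \<Rightarrow> real"
    and g0 h0 :: "'k \<Rightarrow> real ^ 'k \<Rightarrow> real" and g1 h1 :: "'k \<Rightarrow> 'v \<Rightarrow> real ^ 'k \<Rightarrow> real"
  assumes nlp: "central_nlp P"
    and KKT: "central_KKT P ps"
    and central: "central_regular P ps"
    and agents: "local_regular P ps"
    and form: "neighbor_affine P f0 f1 g0 g1 h0 h1"
    and f1: "\<And>i j. j \<in> nbrs P i \<Longrightarrow>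
        hess_block_zero (prims P i) (prims P j) (f1 i j) ps \<and>
        hess_block_zero (prims P j) (prims P j) (f1 i j) ps"
    and g1: "\<And>i j k. j \<in> nbrs P i \<Longrightarrow> k \<in> eqs P i \<Longrightarrow>
        grad_block_zero (prims P j) (g1 k j) ps \<and>
        hess_block_zero (prims P i) (prims P j) (g1 k j) ps \<and>
        hess_block_zero (prims P j) (prims P j) (g1 k j) ps"
    and h1: "\<And>i j k. j \<in> nbrs P i \<Longrightarrow> k \<in> ineqs P i \<Longrightarrow>
        grad_block_zero (prims P j) (h1 k j) ps \<and>
        hess_block_zero (prims P i) (prims P j) (h1 k j) ps \<and>
        hess_block_zero (prims P j) (prims P j) (h1 k j) ps"
  shows "(\<exists>\<Phi>. solution_map P ps \<Phi>) \<and>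
    (\<forall>\<Phi>. solution_map P ps \<Phi> \<longrightarrow> quadratically_convergent \<Phi> ps)"
proof (intro conjI allI impI)
  show "\<exists>\<Phi>. solution_map P ps \<Phi>"
    by (rule solution_map_exists[OF nlp KKT central agents])
  fix \<Phi> assume "solution_map P ps \<Phi>"
  with neighbor_affine_imp_decoupled[OF form f1 g1 h1]
  obtain C d where "d > 0" "\<And>q. q \<in> ball ps d \<Longrightarrow> norm (\<Phi> q - ps) \<le> C * (norm (q - ps))\<^sup>2"
    using solution_map_quadratic_step[OF nlp KKT central agents] by metis
  then show "quadratically_convergent \<Phi> ps"
    by (rule quadratic_step_imp_convergent)
qed

end
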